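(* The identity map $\iota:\mathcal S_1\otimes_{\min}\mathcal S_1\to\mathcal S_1\otimes_{\max}\mathcal S_1$ is positive but not $2$-positive. In particular $\mathcal S_1\otimes_{\rm c}\mathcal S_1=\mathcal S_1\otimes_{\min}\mathcal S_1\neq\mathcal S_1\otimes_{\max}\mathcal S_1$.
   Context: $\mathcal S_1=\mathrm{span}\{1,z,\bar z\}\subseteq C(\mathbb T)\cong C^*(\mathbb F_1)$, $z$ the identity function on the unit circle. $\otimes_{\min}$ is the spatial tensor product (so $\mathcal S_1\otimes_{\min}\mathcal S_1\subseteq C(\mathbb T^2)$ with the induced matrix order); $\otimes_{\max}$ is the maximal operator system tensor product (matrix cones the Archimedeanization of $\{A^*(P\otimes Q)A: P\in M_k(\mathcal S)_+,Q\in M_m(\mathcal T)_+, A \text{ scalar}\}$); $\otimes_{\rm c}$ is the commuting tensor product (positivity tested by all $\phi\cdot\psi$ with $\phi,\psi$ completely positive with commuting ranges, $(\phi\cdot\psi)(x\otimes y)=\phi(x)\psi(y)$). *)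

theory Defs
  imports "HOL-Analysis.Analysis" "HOL-Library.Complex_Order"
begin

text \<open>
Concrete model.  S1 = span{z^a : a in {-1,0,1}} inside C(T).
A complex n x n matrix is a function nat => nat => complex (entries r,s < n).
An element of M_n(S1) is given by its coefficient matrices P a (a in {-1,0,1}),
i.e. P = sum_a P a * z^a.  An element of M_n(S1 (x) S1) is given by coefficient
matrices X a b, i.e. X = sum_{a,b} X a b * z^a (x) w^b.
\<close>

type_synonym cmat = "nat \<Rightarrow> nat \<Rightarrow> complex"

definition Dexp :: "int set" where
  "Dexp = {-1, 0, 1}"

definition psd :: "nat \<Rightarrow> cmat \<Rightarrow> bool" where
  "psd n A \<longleftrightarrow> (\<forall>v :: nat \<Rightarrow> complex.
      0 \<le> (\<Sum>i<n. \<Sum>j<n. cnj (v i) * A i j * v j))"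

definition S1_pos :: "nat \<Rightarrow> (int \<Rightarrow> cmat) \<Rightarrow> bool" where
  "S1_pos k P \<longleftrightarrow> (\<forall>z::complex. cmod z = 1 \<longrightarrow>
      psd k (\<lambda>i j. \<Sum>a\<in>Dexp. P a i j * z powi a))"

text \<open>Minimal (spatial) tensor product: induced order from C(T^2).\<close>
definition min_pos :: "nat \<Rightarrow> (int \<Rightarrow> int \<Rightarrow> cmat) \<Rightarrow> bool" where
  "min_pos n X \<longleftrightarrow> (\<forall>z w::complex. cmod z = 1 \<longrightarrow> cmod w = 1 \<longrightarrow>
      psd n (\<lambda>r s. \<Sum>a\<in>Dexp. \<Sum>b\<in>Dexp. X a b r s * z powi a * w powi b))"

text \<open>Maximal tensor product: the set D_n of all A^* (P (x) Q) A with P in M_k(S1)_+,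
  Q in M_m(S1)_+, A a scalar (km) x n matrix; row index (i,p) of P (x) Q is i*m+p.\<close>
definition max_D :: "nat \<Rightarrow> (int \<Rightarrow> int \<Rightarrow> cmat) \<Rightarrow> bool" where
  "max_D n X \<longleftrightarrow> (\<exists>k m P Q (A::cmat). S1_pos k P \<and> S1_pos m Q \<and>
      (\<forall>a\<in>Dexp. \<forall>b\<in>Dexp. \<forall>r<n. \<forall>s<n.
         X a b r s = (\<Sum>i<k. \<Sum>j<k. \<Sum>p<m. \<Sum>q<m.
             cnj (A (i*m+p) r) * (P a i j * Q b p q) * A (j*m+q) s)))"

text \<open>Archimedeanization with respect to the unit 1 (x) 1: X is positive iff
  X + eps * (I_n (x) 1 (x) 1) lies in D_n for every eps > 0.\<close>
definition max_pos :: "nat \<Rightarrow> (int \<Rightarrow> int \<Rightarrow> cmat) \<Rightarrow> bool" where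
  "max_pos n X \<longleftrightarrow> (\<forall>\<epsilon>::real. \<epsilon> > 0 \<longrightarrow>
      max_D n (\<lambda>a b r s. X a b r s +
         (if a = 0 \<and> b = 0 \<and> r = s then complex_of_real \<epsilon> else 0)))"

definition l2 :: "('i \<Rightarrow> complex) set" where
  "l2 = {f. (\<lambda>i. (cmod (f i))\<^sup>2) summable_on UNIV}"

definition l2inner :: "('i \<Rightarrow> complex) \<Rightarrow> ('i \<Rightarrow> complex) \<Rightarrow> complex" where
  "l2inner f g = (\<Sum>\<^sub>\<infinity>i. f i * cnj (g i))"

definition l2norm :: "('i \<Rightarrow> complex) \<Rightarrow> real" where
  "l2norm f = sqrt (\<Sum>\<^sub>\<infinity>i. (cmod (f i))\<^sup>2)"

definition bounded_op :: "(('i \<Rightarrow> complex) \<Rightarrow> ('i \<Rightarrow> complex)) \<Rightarrow> bool" where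
  "bounded_op T \<longleftrightarrow> (\<forall>f\<in>l2. T f \<in> l2) \<and>
     (\<forall>f\<in>l2. \<forall>g\<in>l2. T (\<lambda>i. f i + g i) = (\<lambda>i. T f i + T g i)) \<and>
     (\<forall>f\<in>l2. \<forall>c. T (\<lambda>i. c * f i) = (\<lambda>i. c * T f i)) \<and>
     (\<exists>C. \<forall>f\<in>l2. l2norm (T f) \<le> C * l2norm f)"

definition op_psd :: "nat \<Rightarrow> (nat \<Rightarrow> nat \<Rightarrow> ('i \<Rightarrow> complex) \<Rightarrow> ('i \<Rightarrow> complex)) \<Rightarrow> bool" where
  "op_psd n T \<longleftrightarrow> (\<forall>h :: nat \<Rightarrow> 'i \<Rightarrow> complex. (\<forall>j<n. h j \<in> l2) \<longrightarrow>
      0 \<le> (\<Sum>r<n. \<Sum>s<n. l2inner (T r s (h s)) (h r)))"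

text \<open>A linear map phi : S1 -> B(H) is given by Phi a = phi(z^a).  Complete positivity.\<close>
definition cp_S1 :: "(int \<Rightarrow> ('i \<Rightarrow> complex) \<Rightarrow> ('i \<Rightarrow> complex)) \<Rightarrow> bool" where
  "cp_S1 \<Phi> \<longleftrightarrow> (\<forall>a\<in>Dexp. bounded_op (\<Phi> a)) \<and>
     (\<forall>k P. S1_pos k P \<longrightarrow>
        op_psd k (\<lambda>i j f t. \<Sum>a\<in>Dexp. P a i j * \<Phi> a f t))"

definition commuting_ranges ::
  "(int \<Rightarrow> ('i \<Rightarrow> complex) \<Rightarrow> ('i \<Rightarrow> complex)) \<Rightarrow>
   (int \<Rightarrow> ('i \<Rightarrow> complex) \<Rightarrow> ('i \<Rightarrow> complex)) \<Rightarrow> bool" where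
  "commuting_ranges \<Phi> \<Psi> \<longleftrightarrow>
     (\<forall>a\<in>Dexp. \<forall>b\<in>Dexp. \<forall>f\<in>l2. \<Phi> a (\<Psi> b f) = \<Psi> b (\<Phi> a f))"

text \<open>Commuting tensor product, tested with cp maps into B(l2('i)):
  (phi . psi)(z^a (x) w^b) = phi(z^a) psi(w^b).\<close>
definition comm_pos :: "'i itself \<Rightarrow> nat \<Rightarrow> (int \<Rightarrow> int \<Rightarrow> cmat) \<Rightarrow> bool" where
  "comm_pos _ n X \<longleftrightarrow> (\<forall>\<Phi> \<Psi> :: int \<Rightarrow> ('i \<Rightarrow> complex) \<Rightarrow> ('i \<Rightarrow> complex).
      cp_S1 \<Phi> \<longrightarrow> cp_S1 \<Psi> \<longrightarrow> commuting_ranges \<Phi> \<Psi> \<longrightarrow>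
      op_psd n (\<lambda>r s f t. \<Sum>a\<in>Dexp. \<Sum>b\<in>Dexp. X a b r s * \<Phi> a (\<Psi> b f) t))"

end

theory Submission
  imports Defs
begin

text \<open>
  \<^bold>\<open>Positive.\<close> A function \<open>x\<^sub>0 + x\<^sub>1 w + x\<^sub>-\<^sub>1 w\<^sup>-\<^sup>1\<close> with \<open>x\<^sub>b\<close> in \<open>S\<^sub>1\<close> is nonnegative for all unimodular
  \<open>w\<close> iff the matrix \<open>P = [[x\<^sub>0/2, x\<^sub>1], [x\<^sub>-\<^sub>1, x\<^sub>0/2]]\<close> is positive over \<open>S\<^sub>1\<close>, and the function is the
  sum of the entrywise tensor products of \<open>P\<close> and the positive matrix \<open>[[1, w], [w\<^sup>-\<^sup>1, 1]]\<close>.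

  \<^bold>\<open>Commuting equals minimal.\<close> A completely positive map on \<open>S\<^sub>1\<close> is a pair \<open>A, B\<close> of operators (the
  images of \<open>1\<close> and \<open>z\<close>) for which \<open>[[A, B], [B\<^sup>*, A]]\<close> is positive. If \<open>R\<close> is a
  polynomial in \<open>A\<close> approximating its inverse, then \<open>W = R B\<close> is a contraction for the form of \<open>A\<close>,
  hence all Fejer kernels \<open>\<Sum> (1 - \<bar>m\<bar>/N) \<zeta>\<^sup>-\<^sup>m A W\<^sup>m\<close> (with adjoints for negative \<open>m\<close>) are positive. Averaging
  them over roots of unity represents the map, up to a vanishing error, by point evaluations with
  positive operator weights in the algebra generated by \<open>A, B, B\<^sup>*\<close>. For two maps with
  commuting ranges the weights commute, so their products are positive, and minimal positivity of \<open>X\<close>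
  gives positivity of its image.

  \<^bold>\<open>Not 2-positive.\<close> The Shifts unextendible product basis of three qubits consists of four
  orthogonal product vectors such that no product vector is orthogonal to all of them. Read as a function on the torus, the sum of the
  four rank one projections is a positive definite element at every point, so it stays minimally
  positive after subtracting a small multiple of the unit. The functional given by the complementary projection is
  nonnegative on the maximal cone, annihilates the sum, and is strictly positive at the unit.
\<close>

section \<open>Square-summable functions and adjointable operators\<close>

lemma l2_product_summable:
  assumes "f \<in> l2" "g \<in> l2"
  shows "(\<lambda>i. f i * cnj (g i)) summable_on UNIV"
proof -
  have "(\<lambda>i. norm (f i * f i)) summable_on UNIV"
    and "(\<lambda>i. norm (cnj (g i) * cnj (g i))) summable_on UNIV"
    using assms by (auto simp: l2_def norm_mult power2_eq_square)
  then have "(\<lambda>i. norm (f i * cnj (g i))) summable_on UNIV"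
    by (rule abs_summable_product)
  then show ?thesis by (rule abs_summable_summable)
qed

lemma l2_add:
  assumes "f \<in> l2" "g \<in> l2"
  shows "(\<lambda>i. f i + g i) \<in> l2"
proof -
  have "(\<lambda>i. 2 * (cmod (f i))\<^sup>2 + 2 * (cmod (g i))\<^sup>2) summable_on UNIV"
    using assms by (intro summable_on_add summable_on_cmult_right) (auto simp: l2_def)
  then have "(\<lambda>i. (cmod (f i + g i))\<^sup>2) summable_on UNIV"
  proof (rule summable_on_comparison_test)
    fix i
    have "(cmod (f i + g i))\<^sup>2 \<le> (cmod (f i) + cmod (g i))\<^sup>2"
      by (intro power_mono norm_triangle_ineq) auto
    also have "\<dots> \<le> 2 * (cmod (f i))\<^sup>2 + 2 * (cmod (g i))\<^sup>2"
      using zero_le_power2[of "cmod (f i) - cmod (g i)"]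
      by (simp add: power2_eq_square algebra_simps)
    finally show "(cmod (f i + g i))\<^sup>2 \<le> 2 * (cmod (f i))\<^sup>2 + 2 * (cmod (g i))\<^sup>2" .
  qed auto
  then show ?thesis by (simp add: l2_def)
qed

lemma l2_scale: "f \<in> l2 \<Longrightarrow> (\<lambda>i. c * f i) \<in> l2"
  by (simp add: l2_def norm_mult power_mult_distrib summable_on_cmult_right)

lemma l2_zero: "(\<lambda>i. 0) \<in> l2"
  by (simp add: l2_def)

lemma l2_uminus: "f \<in> l2 \<Longrightarrow> (\<lambda>i. - f i) \<in> l2"
  by (simp add: l2_def)

lemma l2_minus: "f \<in> l2 \<Longrightarrow> g \<in> l2 \<Longrightarrow> (\<lambda>i. f i - g i) \<in> l2"
  using l2_add[of f "\<lambda>i. - g i"] by (simp add: l2_uminus)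

text \<open>Making the space a type turns its operations into total ones, so that operator
  identities become ring identities open to the simplifier.\<close>

typedef 'i ell2 = "l2 :: ('i \<Rightarrow> complex) set"
  morphisms coord Abs_ell2
  using l2_zero by blast

setup_lifting type_definition_ell2

instantiation ell2 :: (type) ab_group_add
begin

lift_definition zero_ell2 :: "'a ell2" is "\<lambda>i. 0" by (rule l2_zero)
lift_definition plus_ell2 :: "'a ell2 \<Rightarrow> 'a ell2 \<Rightarrow> 'a ell2" is "\<lambda>f g i. f i + g i" by (rule l2_add)
lift_definition minus_ell2 :: "'a ell2 \<Rightarrow> 'a ell2 \<Rightarrow> 'a ell2" is "\<lambda>f g i. f i - g i" by (rule l2_minus)
lift_definition uminus_ell2 :: "'a ell2 \<Rightarrow> 'a ell2" is "\<lambda>f i. - f i" by (rule l2_uminus)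

instance
  by standard (transfer; simp add: fun_eq_iff algebra_simps)+

end

lift_definition scl :: "complex \<Rightarrow> 'i ell2 \<Rightarrow> 'i ell2" is "\<lambda>c f i. c * f i"
  by (rule l2_scale)

lift_definition ip :: "'i ell2 \<Rightarrow> 'i ell2 \<Rightarrow> complex" is l2inner .

lemma ip_add_left: "ip (x + y) z = ip x z + ip y z"
  by transfer (simp add: l2inner_def distrib_right infsum_add l2_product_summable)

lemma ip_cnj: "ip y x = cnj (ip x y)"
  by transfer (simp add: l2inner_def mult.commute flip: infsum_cnj)

lemma ip_add_right: "ip x (y + z) = ip x y + ip x z"
  by (subst (1 2 3) ip_cnj) (simp add: ip_add_left)

lemma ip_scl_left: "ip (scl c x) y = c * ip x y"
  by transfer (simp add: l2inner_def mult.assoc infsum_cmult_right')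

lemma ip_scl_right: "ip x (scl c y) = cnj c * ip x y"
  by (subst (1 2) ip_cnj) (simp add: ip_scl_left)

lemma ip_uminus_left: "ip (- x) y = - ip x y"
proof -
  have "- x = scl (-1) x" by transfer simp
  then show ?thesis using ip_scl_left[of "-1" x y] by simp
qed

lemma ip_uminus_right: "ip x (- y) = - ip x y"
  by (subst (1 2) ip_cnj) (simp add: ip_uminus_left)

lemma ip_diff_left: "ip (x - y) z = ip x z - ip y z"
  using ip_add_left[of x "- y" z] by (simp add: ip_uminus_left)

lemma ip_diff_right: "ip x (y - z) = ip x y - ip x z"
  using ip_add_right[of x y "- z"] by (simp add: ip_uminus_right)

lemma ip_zero_left [simp]: "ip 0 x = 0"
  using ip_add_left[of 0 0 x] by simp

lemma ip_zero_right [simp]: "ip x 0 = 0"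
  using ip_add_right[of x 0 0] by simp

lemma ip_sum_left: "ip (\<Sum>i\<in>I. f i) y = (\<Sum>i\<in>I. ip (f i) y)"
  by (induction I rule: infinite_finite_induct) (auto simp: ip_add_left)

lemma ip_eq_infsum_cmod: "ip x x = complex_of_real (\<Sum>\<^sub>\<infinity>i. (cmod (coord x i))\<^sup>2)"
proof -
  have "(\<lambda>i. (cmod (coord x i))\<^sup>2) summable_on UNIV"
    using coord[of x] by (simp add: l2_def)
  then have "(\<Sum>\<^sub>\<infinity>i. complex_of_real ((cmod (coord x i))\<^sup>2)) 
    = complex_of_real (\<Sum>\<^sub>\<infinity>i. (cmod (coord x i))\<^sup>2)"
    by (metis has_sum_bounded_linear[OF bounded_linear_of_real] has_sum_infsum infsumI)
  moreover have "ip x x = (\<Sum>\<^sub>\<infinity>i. complex_of_real ((cmod (coord x i))\<^sup>2))"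
    unfolding ip.rep_eq l2inner_def by (simp add: complex_norm_square[symmetric])
  ultimately show ?thesis by simp
qed

lemma ip_nonneg: "0 \<le> ip x x"
  unfolding ip_eq_infsum_cmod by (simp add: less_eq_complex_def infsum_nonneg)

lemma ip_definite:
  assumes "ip x x = 0"
  shows "x = 0"
proof -
  have s: "(\<lambda>i. (cmod (coord x i))\<^sup>2) summable_on UNIV"
    using coord[of x] by (simp add: l2_def)
  have "(\<Sum>\<^sub>\<infinity>i. (cmod (coord x i))\<^sup>2) = 0"
    using assms ip_eq_infsum_cmod[of x] by (metis of_real_eq_0_iff)
  then have "(cmod (coord x i))\<^sup>2 = 0" for i
    by (intro nonneg_infsum_le_0D[OF _ s]) auto
  then have "coord x = (\<lambda>i. 0)" by (auto simp: fun_eq_iff)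
  then show ?thesis by (simp add: zero_ell2.rep_eq flip: coord_inject)
qed

lemma ip_ext:
  assumes "\<And>z. ip x z = ip y z"
  shows "x = y"
  using ip_definite[of "x - y"] assms[of "x - y"] by (simp add: ip_diff_left)

text \<open>Linearity of such operators is automatic since the inner product is definite.\<close>

typedef 'i aop = "{T :: 'i ell2 \<Rightarrow> 'i ell2. \<exists>S. \<forall>x y. ip (T x) y = ip x (S y)}"
  morphisms app Abs_aop
  by (rule exI[of _ "\<lambda>_. 0"]) (auto intro!: exI[of _ "\<lambda>_. 0"])

setup_lifting type_definition_aop

section \<open>The ring of adjointable operators\<close>

instantiation aop :: (type) ring_1
begin

lift_definition zero_aop :: "'a aop" is "\<lambda>x. 0"
  by (auto intro!: exI[of _ "\<lambda>_. 0"])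

lift_definition one_aop :: "'a aop" is "\<lambda>x. x"
  by (auto intro!: exI[of _ "\<lambda>x. x"])

lift_definition plus_aop :: "'a aop \<Rightarrow> 'a aop \<Rightarrow> 'a aop" is "\<lambda>S T x. S x + T x"
proof -
  fix S T :: "'a ell2 \<Rightarrow> 'a ell2"
  assume "\<exists>S'. \<forall>x y. ip (S x) y = ip x (S' y)" "\<exists>T'. \<forall>x y. ip (T x) y = ip x (T' y)"
  then obtain S' T' where "\<forall>x y. ip (S x) y = ip x (S' y)" "\<forall>x y. ip (T x) y = ip x (T' y)"
    by blast
  then show "\<exists>R. \<forall>x y. ip (S x + T x) y = ip x (R y)"
    by (intro exI[of _ "\<lambda>y. S' y + T' y"]) (simp add: ip_add_left ip_add_right)
qed

lift_definition minus_aop :: "'a aop \<Rightarrow> 'a aop \<Rightarrow> 'a aop" is "\<lambda>S T x. S x - T x"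
proof -
  fix S T :: "'a ell2 \<Rightarrow> 'a ell2"
  assume "\<exists>S'. \<forall>x y. ip (S x) y = ip x (S' y)" "\<exists>T'. \<forall>x y. ip (T x) y = ip x (T' y)"
  then obtain S' T' where "\<forall>x y. ip (S x) y = ip x (S' y)" "\<forall>x y. ip (T x) y = ip x (T' y)"
    by blast
  then show "\<exists>R. \<forall>x y. ip (S x - T x) y = ip x (R y)"
    by (intro exI[of _ "\<lambda>y. S' y - T' y"]) (simp add: ip_diff_left ip_diff_right)
qed

lift_definition uminus_aop :: "'a aop \<Rightarrow> 'a aop" is "\<lambda>S x. - S x"
proof -
  fix S :: "'a ell2 \<Rightarrow> 'a ell2"
  assume "\<exists>S'. \<forall>x y. ip (S x) y = ip x (S' y)"
  then obtain S' where "\<forall>x y. ip (S x) y = ip x (S' y)"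
    by blast
  then show "\<exists>R. \<forall>x y. ip (- S x) y = ip x (R y)"
    by (intro exI[of _ "\<lambda>y. - S' y"]) (simp add: ip_uminus_left ip_uminus_right)
qed

lift_definition times_aop :: "'a aop \<Rightarrow> 'a aop \<Rightarrow> 'a aop" is "\<lambda>S T x. S (T x)"
proof -
  fix S T :: "'a ell2 \<Rightarrow> 'a ell2"
  assume "\<exists>S'. \<forall>x y. ip (S x) y = ip x (S' y)" "\<exists>T'. \<forall>x y. ip (T x) y = ip x (T' y)"
  then obtain S' T' where "\<forall>x y. ip (S x) y = ip x (S' y)" "\<forall>x y. ip (T x) y = ip x (T' y)"
    by blast
  then show "\<exists>R. \<forall>x y. ip (S (T x)) y = ip x (R y)"
    by (intro exI[of _ "\<lambda>y. T' (S' y)"]) simp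
qed

instance
proof
  fix a b c :: "'a aop"
  show "a * (b + c) = a * b + a * c"
  proof transfer
    fix a b c :: "'a ell2 \<Rightarrow> 'a ell2"
    assume "\<exists>S. \<forall>x y. ip (a x) y = ip x (S y)"
    \<comment> \<open>Only this distributive law needs additivity of \<open>a\<close>, which the
      existence of an adjoint supplies.\<close>
    then obtain S where "\<forall>x y. ip (a x) y = ip x (S y)" by blast
    then have "a (u + v) = a u + a v" for u v
      by (intro ip_ext) (simp add: ip_add_left)
    then show "(\<lambda>x. a (b x + c x)) = (\<lambda>x. a (b x) + a (c x))" by simp
  qed
  show "(0::'a aop) \<noteq> 1"
  proof (transfer, rule notI)
    assume *: "(\<lambda>x::'a ell2. 0) = (\<lambda>x. x)"
    \<comment> \<open>A coordinate vector exists because types are nonempty; it is nonzero, so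
      identity and zero differ.\<close>
    have "(\<lambda>i. if i = j then 1 else 0 :: complex) \<in> l2" for j :: 'a
    proof -
      have "(\<lambda>i. (cmod (if i = j then 1 else 0 :: complex))\<^sup>2) summable_on {j}" by simp
      then show ?thesis unfolding l2_def mem_Collect_eq
        by (rule summable_on_cong_neutral[THEN iffD1, rotated -1]) auto
    qed
    then obtain x :: "'a ell2" where x: "coord x = (\<lambda>i. if i = undefined then 1 else 0)"
      by (metis Abs_ell2_inverse)
    have "x = 0" using * by metis
    then show False using x by (metis zero_ell2.rep_eq one_neq_zero)
  qed
qed (transfer; simp add: fun_eq_iff algebra_simps)+

end

lemma app_add_right: "app T (x + y) = app T x + app T y"
proof -
  obtain S where "\<forall>x y. ip (app T x) y = ip x (S y)" using app[of T] by blast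
  then show ?thesis by (intro ip_ext) (simp add: ip_add_left)
qed

lemma app_scl: "app T (scl c x) = scl c (app T x)"
proof -
  obtain S where "\<forall>x y. ip (app T x) y = ip x (S y)" using app[of T] by blast
  then show ?thesis by (intro ip_ext) (simp add: ip_scl_left)
qed

lemmas app_simps [simp] = zero_aop.rep_eq one_aop.rep_eq plus_aop.rep_eq minus_aop.rep_eq
  uminus_aop.rep_eq times_aop.rep_eq

lemma app_sum: "app (\<Sum>i\<in>I. f i) x = (\<Sum>i\<in>I. app (f i) x)"
  by (induction I rule: infinite_finite_induct) auto

lemma aop_eqI:
  assumes "\<And>x y. ip (app S x) y = ip (app T x) y"
  shows "S = T"
proof -
  have "app S x = app T x" for x using assms by (intro ip_ext)
  then show ?thesis by (metis app_inject ext)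
qed

text \<open>The choice is harmless: definiteness of the inner product leaves only one adjoint, as
  \<open>star_unique\<close> records. The obligation holds because \<open>T\<close> is in turn an
  adjoint of its adjoint.\<close>

lift_definition star :: "'i aop \<Rightarrow> 'i aop" is
  "\<lambda>T. SOME S. \<forall>x y. ip (T x) y = ip x (S y)"
proof -
  fix T :: "'i ell2 \<Rightarrow> 'i ell2"
  let ?S = "SOME S. \<forall>x y. ip (T x) y = ip x (S y)"
  assume "\<exists>S. \<forall>x y. ip (T x) y = ip x (S y)"
  then have *: "\<forall>x y. ip (T x) y = ip x (?S y)" by (rule someI_ex)
  have "ip (?S x) y = ip x (T y)" for x y
    using *[THEN spec, THEN spec, of y x] ip_cnj[of "?S x" y] ip_cnj[of x "T y"] by argo
  then show "\<exists>S. \<forall>x y. ip (?S x) y = ip x (S y)" by blast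
qed

lemma ip_star_right: "ip x (app (star T) y) = ip (app T x) y"
proof -
  have "\<exists>S. \<forall>x y. ip (app T x) y = ip x (S y)" using app[of T] by blast
  then have "\<forall>x y. ip (app T x) y = ip x ((SOME S. \<forall>x y. ip (app T x) y = ip x (S y)) y)"
    by (rule someI_ex)
  from this[THEN spec, THEN spec, of x y] show ?thesis
    unfolding star.rep_eq by (rule sym)
qed

lemma ip_star_left: "ip (app (star T) x) y = ip x (app T y)"
  by (subst (1 2) ip_cnj) (simp add: ip_star_right)

lemma star_unique:
  assumes "\<And>x y. ip (app S x) y = ip x (app T y)"
  shows "star S = T"
proof (rule aop_eqI)
  fix x y
  have "ip (app (star S) x) y = cnj (ip (app S y) x)"
    by (simp add: ip_star_left flip: ip_cnj)
  also have "\<dots> = ip (app T x) y"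
    by (simp add: assms flip: ip_cnj)
  finally show "ip (app (star S) x) y = ip (app T x) y" .
qed

lemma star_star [simp]: "star (star T) = T"
  by (rule star_unique) (simp add: ip_star_left)

lemma star_add [simp]: "star (S + T) = star S + star T"
  by (rule star_unique) (simp add: ip_star_right ip_add_left ip_add_right)

lemma star_diff [simp]: "star (S - T) = star S - star T"
  by (rule star_unique) (simp add: ip_star_right ip_diff_left ip_diff_right)

lemma star_uminus [simp]: "star (- T) = - star T"
  by (rule star_unique) (simp add: ip_star_right ip_uminus_left ip_uminus_right)

lemma star_mult [simp]: "star (S * T) = star T * star S"
  by (rule star_unique) (simp add: ip_star_right)

lemma star_one [simp]: "star 1 = 1"
  by (rule star_unique) simp

lemma star_zero [simp]: "star 0 = 0"
  by (rule star_unique) simp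

lemma star_power [simp]: "star (T ^ n) = star T ^ n"
  by (induction n) (auto simp: power_commutes)

lemma star_sum [simp]: "star (\<Sum>i\<in>I. f i) = (\<Sum>i\<in>I. star (f i))"
  by (induction I rule: infinite_finite_induct) auto

text \<open>Complex scalars enter as central ring elements, so scalar multiples are handled by ring
  arithmetic together with \<open>cs_commute\<close>.\<close>

lift_definition cs :: "complex \<Rightarrow> 'i aop" is scl
proof -
  fix c :: complex
  show "\<exists>S. \<forall>x y::'i ell2. ip (scl c x) y = ip x (S y)"
    by (intro exI[of _ "scl (cnj c)"]) (simp add: ip_scl_left ip_scl_right)
qed

lemma ip_cs: "ip (app (cs c * T) x) y = c * ip (app T x) y"
  by (simp add: cs.rep_eq ip_scl_left)

lemma cs_commute: "T * cs c = cs c * T"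
  by (rule aop_eqI) (simp add: cs.rep_eq app_scl)

lemma cs_commute_left: "T * (cs c * S) = cs c * (T * S)"
  by (metis cs_commute mult.assoc)

lemma cs_mult: "cs a * cs b = cs (a * b)"
  by (rule aop_eqI) (simp add: cs.rep_eq ip_scl_left)

lemma cs_mult_left: "cs a * (cs b * T) = cs (a * b) * T"
  by (simp add: cs_mult flip: mult.assoc)

lemma cs_add: "cs a + cs b = cs (a + b)"
  by (rule aop_eqI) (simp add: cs.rep_eq ip_scl_left ip_add_left algebra_simps)

lemma cs_diff: "cs a - cs b = cs (a - b)"
  by (rule aop_eqI) (simp add: cs.rep_eq ip_scl_left ip_diff_left algebra_simps)

lemma cs_one [simp]: "cs 1 = 1"
  by (rule aop_eqI) (simp add: cs.rep_eq ip_scl_left)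

lemma cs_zero [simp]: "cs 0 = 0"
  by (rule aop_eqI) (simp add: cs.rep_eq ip_scl_left)

lemma cs_of_nat: "cs (of_nat n) = of_nat n"
  by (induction n) (auto simp flip: cs_add)

lemma cs_sum: "cs (\<Sum>i\<in>I. c i) = (\<Sum>i\<in>I. cs (c i))"
  by (induction I rule: infinite_finite_induct) (auto simp flip: cs_add)

lemma star_cs [simp]: "star (cs c) = cs (cnj c)"
  by (rule star_unique) (simp add: cs.rep_eq ip_scl_left ip_scl_right)

section \<open>Positive operators\<close>

lemma complex_nonneg_limit:
  fixes f :: "nat \<Rightarrow> complex"
  assumes "f \<longlonglongrightarrow> l" "\<And>n. 0 \<le> f n"
  shows "0 \<le> l"
proof -
  have "(\<lambda>n. Re (f n)) \<longlonglongrightarrow> Re l" "(\<lambda>n. Im (f n)) \<longlonglongrightarrow> Im l"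
    using assms(1) by (auto intro: tendsto_intros)
  moreover have "Re (f n) \<ge> 0" "Im (f n) = 0" for n
    using assms(2)[of n] by (auto simp: less_eq_complex_def)
  ultimately have "Re l \<ge> 0" "Im l = 0"
    by (auto intro: LIMSEQ_le_const simp: LIMSEQ_const_iff)
  then show ?thesis by (simp add: less_eq_complex_def)
qed

definition nrm :: "'i ell2 \<Rightarrow> real" where
  "nrm x = sqrt (Re (ip x x))"

lemma nrm_nonneg [simp]: "nrm x \<ge> 0"
  using ip_nonneg[of x] by (simp add: nrm_def less_eq_complex_def)

lemma ip_eq_nrm: "ip x x = complex_of_real ((nrm x)\<^sup>2)"
  using ip_nonneg[of x] by (simp add: nrm_def less_eq_complex_def complex_eq_iff)

lemma ip_Cauchy_Schwarz: "cmod (ip x y) \<le> nrm x * nrm y"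
proof (cases "y = 0")
  case False
  define c where "c = ip x y"
  define d where "d = (nrm y)\<^sup>2"
  have d: "d > 0"
    using False ip_definite[of y] ip_eq_nrm[of y] unfolding d_def by fastforce
  have dy: "ip y y = of_real d" by (simp add: ip_eq_nrm d_def)
  have "ip y x = cnj c" unfolding c_def by (rule ip_cnj)
  then have "ip (x - scl (c / of_real d) y) (x - scl (c / of_real d) y)
    = ip x x - c * cnj c / of_real d"
    using d by (simp add: ip_diff_left ip_diff_right ip_scl_left ip_scl_right dy
        flip: c_def)
  then have "0 \<le> ip x x - c * cnj c / of_real d"
    using ip_nonneg by metis
  then have "(cmod c)\<^sup>2 / d \<le> (nrm x)\<^sup>2"
    by (simp add: ip_eq_nrm less_eq_complex_def complex_norm_square[symmetric]
        flip: of_real_power of_real_divide)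
  then have "(cmod c)\<^sup>2 \<le> (nrm x * nrm y)\<^sup>2"
    using d by (simp add: d_def field_simps power_mult_distrib)
  then show ?thesis unfolding c_def
    by (rule power2_le_imp_le) simp
qed simp

lemma ip_tendsto:
  assumes "(\<lambda>n. nrm (u n - u')) \<longlonglongrightarrow> 0" "(\<lambda>n. nrm (v n - v')) \<longlonglongrightarrow> 0"
  shows "(\<lambda>n. ip (u n) (v n)) \<longlonglongrightarrow> ip u' v'"
proof -
  have "(\<lambda>n. ip (u n) (v n) - ip u' v') \<longlonglongrightarrow> 0"
  proof (rule Lim_null_comparison)
    show "\<forall>\<^sub>F n in sequentially. norm (ip (u n) (v n) - ip u' v') \<le>
      nrm (u n - u') * nrm (v n - v') + nrm (u n - u') * nrm v' + nrm u' * nrm (v n - v')"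
    proof (intro always_eventually allI)
      fix n
      have "ip (u n) (v n) - ip u' v'
        = ip (u n - u') (v n - v') + ip (u n - u') v' + ip u' (v n - v')"
        by (simp add: ip_diff_left ip_diff_right)
      also have "norm \<dots> \<le> norm (ip (u n - u') (v n - v')) + norm (ip (u n - u') v')
          + norm (ip u' (v n - v'))"
        by (meson norm_triangle_ineq order_trans add_right_mono)
      also have "\<dots> \<le> nrm (u n - u') * nrm (v n - v') + nrm (u n - u') * nrm v' + nrm u' * nrm (v n - v')"
        by (intro add_mono ip_Cauchy_Schwarz)
      finally show "norm (ip (u n) (v n) - ip u' v') \<le>
        nrm (u n - u') * nrm (v n - v') + nrm (u n - u') * nrm v' + nrm u' * nrm (v n - v')" .
    qed
    show "(\<lambda>n. nrm (u n - u') * nrm (v n - v') + nrm (u n - u') * nrm v' + nrm u' * nrm (v n - v')) \<longlonglongrightarrow> 0"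
      using assms by (auto intro!: tendsto_eq_intros)
  qed
  then show ?thesis by (simp add: LIM_zero_iff)
qed

definition pos :: "'i aop \<Rightarrow> bool" where
  "pos T \<longleftrightarrow> (\<forall>x. 0 \<le> ip (app T x) x)"

lemma pos_zero [simp]: "pos 0" by (simp add: pos_def)

lemma pos_one [simp]: "pos 1" by (simp add: pos_def ip_nonneg)

lemma pos_add: "pos S \<Longrightarrow> pos T \<Longrightarrow> pos (S + T)"
  by (simp add: pos_def ip_add_left)

lemma pos_sum: "(\<And>i. i \<in> I \<Longrightarrow> pos (f i)) \<Longrightarrow> pos (\<Sum>i\<in>I. f i)"
  by (induction I rule: infinite_finite_induct) (auto intro: pos_add)

lemma pos_sandwich: "pos T \<Longrightarrow> pos (star S * T * S)"
  by (simp add: pos_def ip_star_left)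

lemma pos_cs: "0 \<le> c \<Longrightarrow> pos T \<Longrightarrow> pos (cs c * T)"
  unfolding pos_def ip_cs by simp

lemma pos_of_nat: "pos T \<Longrightarrow> pos (of_nat n * T)"
  by (induction n) (auto intro: pos_add simp: distrib_right)

lemma pos_cs_diff_mono:
  assumes "pos (cs (complex_of_real c) - T)" "c \<le> d"
  shows "pos (cs (complex_of_real d) - T)"
proof -
  have "cs (complex_of_real d) - T = (cs (complex_of_real c) - T) + cs (complex_of_real (d - c)) * 1"
    by (simp flip: cs_diff)
  also have "pos \<dots>"
    using assms by (intro pos_add pos_cs) (auto simp: less_eq_complex_def)
  finally show ?thesis .
qed

text \<open>Distribute the powers symmetrically: an even power gives a sandwich of \<open>S\<close>,
  an odd power a sandwich of \<open>t * S\<close>.\<close>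

lemma pos_power_mult:
  assumes t: "star t = t" and "pos S" "pos (t * S)" and c: "t * S = S * t"
  shows "pos (t ^ k * S)"
proof -
  have comm: "t ^ j * S = S * t ^ j" for j
    by (induction j) (simp_all add: mult.assoc c, metis c mult.assoc)
  show ?thesis
  proof (cases "even k")
    case True
    then obtain j where "k = j + j" by (metis evenE mult_2)
    then have "t ^ k * S = star (t ^ j) * S * t ^ j"
      by (simp add: power_add t mult.assoc) (simp add: comm)
    then show ?thesis using assms by (simp only: pos_sandwich)
  next
    case False
    then obtain j where "k = j + j + 1" by (metis oddE mult_2)
    then have "t ^ k = t ^ j * t * t ^ j"
      by (simp add: power_add power_commutes mult.assoc)
    then have "t ^ k * S = t ^ j * t * (t ^ j * S)"
      by (simp add: mult.assoc)
    also have "\<dots> = star (t ^ j) * (t * S) * t ^ j"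
      unfolding comm by (simp add: t mult.assoc)
    finally show ?thesis using assms by (simp only: pos_sandwich)
  qed
qed

section \<open>Powers of an operator between 0 and 1\<close>

locale unit_interval_op =
  fixes t :: "'i aop"
  assumes star_t [simp]: "star t = t" and pos_t: "pos t" and t_le_1: "pos (1 - t)"
begin

lemma pos_t_1_t: "pos (t * (1 - t))"
proof -
  \<comment> \<open>A product of two commuting positive operators is rewritten as a sum of
    sandwiches, which are visibly positive.\<close>
  have "t * (1 - t) = star (1 - t) * t * (1 - t) + star t * (1 - t) * t"
    by (simp add: algebra_simps)
  then show ?thesis using pos_t t_le_1 by (simp only: pos_add pos_sandwich)
qed

lemma pos_power: "pos (t ^ k)"
  using pos_power_mult[of t 1 k] pos_t by simp

lemma pos_power_1: "pos (t ^ k * (1 - t))"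
  using pos_t_1_t t_le_1 by (intro pos_power_mult) (auto simp: algebra_simps)

lemma pos_power_2: "pos (t ^ k * ((1 - t) * (1 - t)))"
proof (rule pos_power_mult)
  show "pos ((1 - t) * (1 - t))"
    using pos_sandwich[of 1 "1 - t"] by simp
  have "t * ((1 - t) * (1 - t)) = star (1 - t) * t * (1 - t)"
    by (simp add: algebra_simps)
  then show "pos (t * ((1 - t) * (1 - t)))" using pos_t by (simp only: pos_sandwich)
qed (auto simp: algebra_simps)

text \<open>The difference telescopes into terms \<open>t ^ i * ((1 - t) * (1 - t))\<close>.\<close>

lemma pos_power_1_antimono: "pos (t ^ k * (1 - t) - t ^ (k + d) * (1 - t))"
proof (induction d)
  case (Suc d)
  have "t ^ k * (1 - t) - t ^ (k + Suc d) * (1 - t)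
    = (t ^ k * (1 - t) - t ^ (k + d) * (1 - t)) + t ^ (k + d) * ((1 - t) * (1 - t))"
    by (simp add: algebra_simps power_commutes) (metis power_Suc2 power_commutes mult.assoc)
  then show ?case using Suc pos_power_2 by (simp only: pos_add)
qed simp

text \<open>\<open>1 - t ^ Suc m\<close> is the sum of the \<open>m + 1\<close> terms
  \<open>t ^ i * (1 - t)\<close>, and the last of these is the smallest.\<close>

lemma pos_power_1_bound: "pos (1 - of_nat (Suc m) * (t ^ m * (1 - t)))"
proof -
  have "pos (1 - t ^ Suc m - of_nat (Suc m) * (t ^ m * (1 - t)))"
  proof (induction m)
    case (Suc m)
    have e: "t ^ Suc (Suc m) = t ^ Suc m - t ^ Suc m * (1 - t)"
      by (simp add: algebra_simps power_commutes)
    have "1 - t ^ Suc (Suc m) - of_nat (Suc (Suc m)) * (t ^ Suc m * (1 - t))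
      = (1 - t ^ Suc m - of_nat (Suc m) * (t ^ m * (1 - t)))
        + of_nat (Suc m) * (t ^ m * (1 - t) - t ^ (m + 1) * (1 - t))"
      unfolding e by (simp add: algebra_simps)
    then show ?case using Suc pos_power_1_antimono[of m 1]
      by (simp only: pos_add pos_of_nat)
  qed simp
  from pos_add[OF this pos_power[of "Suc m"]] show ?thesis by simp
qed

lemma pos_step: "unit_interval_op (t - t * t)"
proof
  have "t - t * t = t * (1 - t)" by (simp add: algebra_simps)
  then show "pos (t - t * t)" using pos_t_1_t by simp
  have "1 - (t - t * t) = (1 - t) + star t * 1 * t" by simp
  then show "pos (1 - (t - t * t))"
    using t_le_1 by (simp only: pos_add pos_sandwich pos_one)
qed simp

end

text \<open>This is positivity of the operator matrix with entries \<open>F r s * Q\<close>, the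
  tensor product of a scalar matrix and an operator.\<close>

definition Fpos :: "nat \<Rightarrow> cmat \<Rightarrow> 'i aop \<Rightarrow> bool" where
  "Fpos n F Q \<longleftrightarrow> (\<forall>h. 0 \<le> (\<Sum>r<n. \<Sum>s<n. F r s * ip (app Q (h s)) (h r)))"

lemma summable_on_sum:
  fixes f :: "'a \<Rightarrow> 'b \<Rightarrow> complex"
  assumes "\<And>k. k \<in> K \<Longrightarrow> f k summable_on A"
  shows "(\<lambda>x. \<Sum>k\<in>K. f k x) summable_on A"
  using assms
  by (induction K rule: infinite_finite_induct) (auto simp: summable_on_add)

lemma infsum_sum:
  fixes f :: "'a \<Rightarrow> 'b \<Rightarrow> complex"
  assumes "\<And>k. k \<in> K \<Longrightarrow> f k summable_on A"
  shows "(\<Sum>\<^sub>\<infinity>x\<in>A. \<Sum>k\<in>K. f k x) = (\<Sum>k\<in>K. infsum (f k) A)"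
  using assms
  by (induction K rule: infinite_finite_induct) (auto simp: infsum_add summable_on_sum)

text \<open>Summed coordinate by coordinate, the form is an infinite sum of values of the scalar
  form of \<open>F\<close>.\<close>

lemma Fpos_one:
  assumes "psd n F"
  shows "Fpos n F 1"
  unfolding Fpos_def
proof
  fix h :: "nat \<Rightarrow> 'i ell2"
  have sm: "(\<lambda>i. F r s * (coord (h s) i * cnj (coord (h r) i))) summable_on UNIV" for r s
    by (intro summable_on_cmult_right l2_product_summable coord)
  have "(\<Sum>r<n. \<Sum>s<n. F r s * ip (h s) (h r))
    = (\<Sum>r<n. \<Sum>s<n. \<Sum>\<^sub>\<infinity>i. F r s * (coord (h s) i * cnj (coord (h r) i)))"
    by (simp add: ip.rep_eq l2inner_def infsum_cmult_right')
  also have "\<dots> = (\<Sum>r<n. \<Sum>\<^sub>\<infinity>i. \<Sum>s<n. F r s * (coord (h s) i * cnj (coord (h r) i)))"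
    by (intro sum.cong refl infsum_sum[symmetric] sm)
  also have "\<dots> = (\<Sum>\<^sub>\<infinity>i. \<Sum>r<n. \<Sum>s<n. F r s * (coord (h s) i * cnj (coord (h r) i)))"
    by (intro infsum_sum[symmetric] summable_on_sum sm)
  also have "\<dots> \<ge> 0"
  proof (rule infsum_nonneg_complex)
    show "(\<lambda>i. \<Sum>r<n. \<Sum>s<n. F r s * (coord (h s) i * cnj (coord (h r) i))) summable_on UNIV"
      by (intro summable_on_sum sm)
    fix i
    have "0 \<le> (\<Sum>r<n. \<Sum>s<n. cnj (coord (h r) i) * F r s * coord (h s) i)"
      using assms unfolding psd_def by (rule spec)
    then show "0 \<le> (\<Sum>r<n. \<Sum>s<n. F r s * (coord (h s) i * cnj (coord (h r) i)))"
      by (simp add: mult_ac)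
  qed
  finally show "0 \<le> (\<Sum>r<n. \<Sum>s<n. F r s * ip (app 1 (h s)) (h r))" by simp
qed

text \<open>F. Riesz: for \<open>0 \<le> T \<le> 1\<close> put \<open>T\<^sub>0 = T\<close> and \<open>T\<^sub>k\<^sub>+\<^sub>1 = T\<^sub>k - T\<^sub>k\<^sup>2\<close>. Then
  \<open>T = T\<^sub>0\<^sup>2 + \<dots> + T\<^sub>N\<^sub>-\<^sub>1\<^sup>2 + T\<^sub>N\<close> and \<open>T\<^sub>N\<close> tends strongly to 0, which replaces the square root of \<open>T\<close>.\<close>

primrec riesz :: "'i aop \<Rightarrow> nat \<Rightarrow> 'i aop" where
  "riesz T 0 = T"
| "riesz T (Suc k) = riesz T k - riesz T k * riesz T k"

lemma riesz_sum: "T = (\<Sum>k<N. riesz T k * riesz T k) + riesz T N"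
  by (induction N) (auto simp: algebra_simps)

lemma riesz_commute:
  assumes "T * Q = Q * T"
  shows "riesz T k * Q = Q * riesz T k"
proof (induction k)
  case (Suc k)
  have "riesz T k * riesz T k * Q = Q * (riesz T k * riesz T k)"
    by (metis Suc mult.assoc)
  then show ?case using Suc by (simp add: algebra_simps)
qed (use assms in simp)

lemma riesz_unit_interval:
  assumes "unit_interval_op T"
  shows "unit_interval_op (riesz T k)"
  by (induction k) (use assms unit_interval_op.pos_step in auto)

text \<open>The squares of the iterates add up to at most \<open>T\<close>, so the squared norms of
  the images of \<open>x\<close> are summable.\<close>

lemma riesz_tendsto_0:
  assumes "unit_interval_op T"
  shows "(\<lambda>k. nrm (app (riesz T k) x)) \<longlonglongrightarrow> 0"
proof -
  have u: "star (riesz T k) = riesz T k" "pos (riesz T k)" for k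
    using riesz_unit_interval[OF assms, of k] by (auto simp: unit_interval_op_def)
  have "(\<Sum>k<N. (nrm (app (riesz T k) x))\<^sup>2) \<le> Re (ip (app T x) x)" for N
  proof -
    have "ip (app T x) x = (\<Sum>k<N. ip (app (riesz T k * riesz T k) x) x) + ip (app (riesz T N) x) x"
      by (subst riesz_sum[of T N]) (simp add: app_sum ip_sum_left ip_add_left)
    also have "(\<Sum>k<N. ip (app (riesz T k * riesz T k) x) x)
        = (\<Sum>k<N. complex_of_real ((nrm (app (riesz T k) x))\<^sup>2))"
      using ip_star_left[of "riesz T k" for k] u(1)
      by (intro sum.cong refl) (simp add: ip_eq_nrm)
    finally have "Re (ip (app T x) x) = (\<Sum>k<N. (nrm (app (riesz T k) x))\<^sup>2) + Re (ip (app (riesz T N) x) x)"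
      by (simp flip: of_real_power)
    then show ?thesis using u(2)[of N] by (simp add: pos_def less_eq_complex_def)
  qed
  then have "summable (\<lambda>k. (nrm (app (riesz T k) x))\<^sup>2)"
    by (intro summableI_nonneg_bounded) auto
  then have "(\<lambda>k. sqrt ((nrm (app (riesz T k) x))\<^sup>2)) \<longlonglongrightarrow> sqrt 0"
    by (intro tendsto_real_sqrt summable_LIMSEQ_zero)
  then show ?thesis by simp
qed

text \<open>In the Riesz decomposition of \<open>T * Q\<close> each square contributes the form of
  \<open>Q\<close> at the vectors \<open>app (riesz T k) (h r)\<close>, and the remainder vanishes
  in the limit.\<close>

lemma Fpos_times_unit_interval:
  assumes T: "unit_interval_op T" and c: "T * Q = Q * T" and Q: "Fpos n F Q"
  shows "Fpos n F (T * Q)"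
  unfolding Fpos_def
proof
  fix h
  define S where "S = (\<Sum>r<n. \<Sum>s<n. F r s * ip (app (T * Q) (h s)) (h r))"
  \<comment> \<open>The remainder \<open>riesz T N\<close> is moved to the right argument, so strong
    convergence on the fixed vectors \<open>h r\<close> is enough.\<close>
  define e where "e N = (\<Sum>r<n. \<Sum>s<n. F r s * ip (app Q (h s)) (app (riesz T N) (h r)))" for N
  have u: "star (riesz T k) = riesz T k" for k
    using riesz_unit_interval[OF T, of k] by (auto simp: unit_interval_op_def)
  have sa: "ip (app (riesz T k) x) y = ip x (app (riesz T k) y)" for k x y
    using ip_star_left[of "riesz T k" x y] u by simp
  have nn: "0 \<le> S - e N" for N
  proof -
    have "ip (app (T * Q) x) y = (\<Sum>k<N. ip (app Q (app (riesz T k) x)) (app (riesz T k) y))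
        + ip (app Q x) (app (riesz T N) y)" for x y
    proof -
      have cc: "app (riesz T k) (app Q z) = app Q (app (riesz T k) z)" for k z
        using riesz_commute[OF c, of k] by (metis times_aop.rep_eq)
      have "T * Q = ((\<Sum>k<N. riesz T k * riesz T k) + riesz T N) * Q"
        using riesz_sum by metis
      then have "ip (app (T * Q) x) y = (\<Sum>k<N. ip (app (riesz T k) (app (riesz T k) (app Q x))) y)
        + ip (app (riesz T N) (app Q x)) y"
        by (simp add: app_sum ip_sum_left ip_add_left)
      moreover have "ip (app (riesz T k) (app (riesz T k) (app Q x))) y
          = ip (app Q (app (riesz T k) x)) (app (riesz T k) y)" for k
        by (subst sa, subst cc) (rule refl)
      ultimately show ?thesis by (simp add: sa)
    qed
    then have "S - e N = (\<Sum>r<n. \<Sum>s<n. \<Sum>k<N. F r s * ip (app Q (app (riesz T k) (h s))) (app (riesz T k) (h r)))"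
      by (simp add: S_def e_def distrib_left sum.distrib sum_distrib_left)
    also have "\<dots> = (\<Sum>r<n. \<Sum>k<N. \<Sum>s<n. F r s * ip (app Q (app (riesz T k) (h s))) (app (riesz T k) (h r)))"
      by (intro sum.cong refl sum.swap)
    also have "\<dots> = (\<Sum>k<N. \<Sum>r<n. \<Sum>s<n. F r s * ip (app Q (app (riesz T k) (h s))) (app (riesz T k) (h r)))"
      by (rule sum.swap)
    also have "\<dots> \<ge> 0"
    proof (rule sum_nonneg)
      fix k
      show "0 \<le> (\<Sum>r<n. \<Sum>s<n. F r s * ip (app Q (app (riesz T k) (h s))) (app (riesz T k) (h r)))"
        using Q unfolding Fpos_def by (rule spec[where x = "\<lambda>r. app (riesz T k) (h r)"])
    qed
    finally show ?thesis .
  qed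
  have "(\<lambda>N. ip (app Q (h s)) (app (riesz T N) (h r))) \<longlonglongrightarrow> ip (app Q (h s)) 0" for r s
    using riesz_tendsto_0[OF T] by (intro ip_tendsto) (auto simp: nrm_def)
  then have "(\<lambda>N. S - e N) \<longlonglongrightarrow> S - (\<Sum>r<n. \<Sum>s<n. F r s * ip (app Q (h s)) 0)"
    unfolding e_def by (intro tendsto_intros)
  then have "(\<lambda>N. S - e N) \<longlonglongrightarrow> S" by simp
  then show "0 \<le> S" using nn by (rule complex_nonneg_limit)
qed

lemma Fpos_cs: "0 \<le> c \<Longrightarrow> Fpos n F Q \<Longrightarrow> Fpos n F (cs c * Q)"
  unfolding Fpos_def ip_cs
  by (simp add: mult.left_commute[of _ c] flip: sum_distrib_left)

lemma Fpos_times: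
  assumes "star T = T" "pos T" "pos (cs (complex_of_real c) - T)" "T * Q = Q * T" "Fpos n F Q"
  shows "Fpos n F (T * Q)"
proof -
  \<comment> \<open>The maximum with 1 gives a bound that is certainly positive, so \<open>T\<close>
    can be divided by it.\<close>
  define d where "d = max c 1"
  have d: "d > 0" by (simp add: d_def)
  have "pos (cs (complex_of_real d) - T)"
    by (rule pos_cs_diff_mono[OF assms(3)]) (simp add: d_def)
  then have "pos (cs (complex_of_real (1/d)) * (cs (complex_of_real d) - T))"
    using d by (intro pos_cs) (auto simp: less_eq_complex_def)
  then have "pos (1 - cs (complex_of_real (1/d)) * T)"
    using d by (simp add: algebra_simps cs_mult)
  moreover have "pos (cs (complex_of_real (1/d)) * T)"
    using d assms by (intro pos_cs) (auto simp: less_eq_complex_def)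
  ultimately have "unit_interval_op (cs (complex_of_real (1/d)) * T)"
    using assms(1) by unfold_locales (auto simp: cs_commute)
  then have "Fpos n F (cs (complex_of_real (1/d)) * T * Q)"
    using assms by (intro Fpos_times_unit_interval) (auto simp: mult.assoc cs_commute_left)
  then have "Fpos n F (cs (complex_of_real d) * (cs (complex_of_real (1/d)) * T * Q))"
    using d by (intro Fpos_cs) (auto simp: less_eq_complex_def)
  then show ?thesis using d by (simp add: mult.assoc cs_mult_left)
qed

section \<open>Positive Toeplitz pairs\<close>

text \<open>The condition \<open>toep\<close> tests the block matrix with rows \<open>A, B\<close>
  and \<open>star B, A\<close> on the vector \<open>(x, y)\<close>; \<open>A_le_1\<close> is a
  normalisation reached by rescaling.\<close>

locale toep_pair =
  fixes A B :: "'i aop"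
  assumes star_A [simp]: "star A = A"
    and toep: "\<And>x y. 0 \<le> ip (app A x) x + ip (app A y) y + ip (app B y) x + ip (app (star B) x) y"
    and A_le_1: "pos (1 - A)"
begin

text \<open>Testing \<open>toep\<close> at the images of one vector under \<open>S1\<close> and
  \<open>S2\<close> turns it into an operator inequality; good choices of \<open>S1, S2\<close> give
  all estimates below.\<close>

lemma toep_sandwich:
  "pos (star S1 * A * S1 + star S2 * A * S2 + star S1 * B * S2 + star S2 * star B * S1)"
  unfolding pos_def using toep by (simp add: ip_add_left ip_star_left)

lemma pos_A: "pos A"
  using toep_sandwich[of 1 0] by simp

sublocale t: unit_interval_op "1 - A"
  by unfold_locales (auto simp: pos_A A_le_1)

text \<open>\<open>A\<close> may fail to be invertible. The truncated Neumann series
  \<open>R K\<close> stands in for its inverse, with defect \<open>E K\<close>, that is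
  \<open>A * R K = 1 - E K\<close>.\<close>

definition E :: "nat \<Rightarrow> 'i aop" where "E K = (1 - A) ^ K"

definition R :: "nat \<Rightarrow> 'i aop" where "R K = (\<Sum>k<K. (1 - A) ^ k)"

definition W :: "nat \<Rightarrow> 'i aop" where "W K = R K * B"

lemma star_E [simp]: "star (E K) = E K"
  by (simp add: E_def)

lemma star_R [simp]: "star (R K) = R K"
  by (simp add: R_def)

lemma A_E: "A * E K = E K * A"
proof -
  have "(1 - A) * E K = E K * (1 - A)" by (simp add: E_def power_commutes)
  then show ?thesis by (simp add: algebra_simps)
qed

lemma A_R: "A * R K = 1 - E K"
proof (induction K)
  case (Suc K)
  have "A * R (Suc K) = A * R K + A * E K" by (simp add: R_def E_def distrib_left)
  also have "\<dots> = 1 - (1 - A) * E K" using Suc by (simp add: algebra_simps)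
  finally show ?case by (simp add: E_def)
qed (simp add: R_def E_def)

lemma R_A: "R K * A = 1 - E K"
  using arg_cong[OF A_R[of K], of star] by simp

text \<open>A Schur complement argument: if \<open>A\<close> were invertible, this would be the
  positivity of \<open>A - star B * inverse A * B\<close>.\<close>

lemma contraction: "pos (A - star (W K) * A * W K)"
proof -
  \<comment> \<open>With this choice both cross terms \<open>star S * B\<close> and
    \<open>star B * S\<close> become \<open>- star (W K) * A * W K\<close>.\<close>
  define S where "S = - (R K * A * W K)"
  have W: "star (W K) = star B * R K" by (simp add: W_def)
  have ara: "A * R K * A * R K * A = A - E K * A - E K * A + E K * E K * A"
    by (simp add: A_R mult.assoc R_A) (simp add: algebra_simps A_E)
  have "pos (star S * A * S + A + star S * B + star B * S)"
    using toep_sandwich[of S 1] by simp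
  also have "star S * A * S + A + star S * B + star B * S
      = A - star (W K) * A * W K - star (W K) * A * W K + star (W K) * (A * R K * A * R K * A) * W K"
    by (simp add: S_def W_def mult.assoc)
  finally have 1: "pos \<dots>" .
  \<comment> \<open>By \<open>ara\<close> this operator is \<open>A - A * R K * A * R K * A\<close>,
    the amount missing in the middle of the quadratic term.\<close>
  have "pos (E K * A + (E K * A - E K * E K * A))"
    using t.pos_power_1[of K] t.pos_power_1_antimono[of K K]
    by (intro pos_add) (auto simp: E_def power_add)
  then have "pos (star (W K) * (E K * A + (E K * A - E K * E K * A)) * W K)"
    by (rule pos_sandwich)
  from pos_add[OF 1 this] show ?thesis
    unfolding ara by (simp add: algebra_simps)
qed

text \<open>With \<open>t = 1 - A\<close> the product is \<open>t ^ (2 * K) * (1 - t)\<close>, so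
  the bound on such powers applies.\<close>

lemma E_A_E: "pos (1 - of_nat (Suc (2 * K)) * (E K * A * E K))"
proof -
  have "E K * A * E K = (1 - A) ^ (2 * K) * (1 - (1 - A))"
    by (simp add: mult.assoc A_E) (simp add: E_def power_add mult_2 mult.assoc)
  then show ?thesis using t.pos_power_1_bound[of "2 * K"] by simp
qed

text \<open>\<open>E K * B\<close> is the error made in replacing \<open>B\<close> by
  \<open>A * W K\<close>. The proof bounds \<open>n\<close> times its square by \<open>A\<close>,
  hence by 1.\<close>

lemma E_B_small: "pos (1 - of_nat (Suc (2 * K)) * (star (E K * B) * (E K * B)))"
proof -
  define n where "n = complex_of_nat (Suc (2 * K))"
  \<comment> \<open>The factor \<open>n\<close> is balanced so that the quadratic term
    \<open>n * n * Z\<close> is absorbed by one copy of \<open>n * Y\<close> through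
    \<open>E_A_E\<close>.\<close>
  define S where "S = - (cs n * (E K * E K * B))"
  have [simp]: "cnj n = n" by (simp add: n_def)
  note cms = cs_commute[of A] cs_commute[of B] cs_commute[of "star B"] cs_commute[of "E K"]
    cs_commute_left[of A] cs_commute_left[of B] cs_commute_left[of "star B"] cs_commute_left[of "E K"]
  define Y where "Y = star B * E K * (E K * B)"
  define Z where "Z = star B * E K * (E K * A * E K) * (E K * B)"
  have "pos (star S * A * S + A + star S * B + star B * S)"
    using toep_sandwich[of S 1] by simp
  also have "star S * A * S + A + star S * B + star B * S
      = A + cs (n * n) * Z - cs n * Y - cs n * Y"
    by (simp add: S_def Y_def Z_def mult.assoc cms cs_mult_left)
  finally have 1: "pos \<dots>" .
  have "pos (cs n * (star (E K * B) * (1 - of_nat (Suc (2 * K)) * (E K * A * E K)) * (E K * B)))"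
    by (intro pos_cs pos_sandwich E_A_E) (auto simp: n_def less_eq_complex_def)
  also have "cs n * (star (E K * B) * (1 - of_nat (Suc (2 * K)) * (E K * A * E K)) * (E K * B))
      = cs n * Y - cs (n * n) * Z"
    unfolding cs_of_nat[symmetric] n_def[symmetric]
    by (simp add: Y_def Z_def mult.assoc cms cs_mult_left
      right_diff_distrib left_diff_distrib)
  finally have 2: "pos (cs n * Y - cs (n * n) * Z)" .
  have "pos (A - cs n * Y)"
    using pos_add[OF 1 2] by (simp add: algebra_simps)
  from pos_add[OF this A_le_1] have "pos (1 - cs n * Y)"
    by (simp add: algebra_simps)
  then show ?thesis
    unfolding cs_of_nat[symmetric] n_def[symmetric] by (simp add: Y_def mult.assoc)
qed

text \<open>Strong convergence does not pass to adjoints, so the error in the coefficient of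
  exponent -1 is estimated separately, by comparison with \<open>E K * A * E K\<close>.\<close>

lemma star_B_E_small: "pos (1 - of_nat (Suc (2 * K)) * (star (star B * E K) * (star B * E K)))"
proof -
  define n where "n = complex_of_nat (Suc (2 * K))"
  define S where "S = - (star B * E K)"
  define Y where "Y = star S * S"
  have "pos (star (E K) * A * E K + star S * A * S + star (E K) * B * S + star S * star B * E K)"
    by (rule toep_sandwich)
  moreover have "pos (star S * (1 - A) * S)" by (intro pos_sandwich A_le_1)
  ultimately have "pos (star (E K) * A * E K + star S * A * S + star (E K) * B * S + star S * star B * E K
      + star S * (1 - A) * S)"
    by (rule pos_add)
  also have "\<dots> = E K * A * E K - Y"
    by (simp add: S_def Y_def algebra_simps)
  finally have "pos (cs n * (E K * A * E K - Y))"
    by (intro pos_cs) (auto simp: n_def less_eq_complex_def)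
  moreover have "pos (1 - cs n * (E K * A * E K))"
    using E_A_E[of K] unfolding cs_of_nat[symmetric] n_def[symmetric] .
  ultimately have "pos (1 - cs n * (E K * A * E K) + cs n * (E K * A * E K - Y))"
    by (intro pos_add)
  then show ?thesis
    unfolding cs_of_nat[symmetric] n_def[symmetric] by (simp add: Y_def S_def right_diff_distrib)
qed

end

lemma nrm_tendsto_0_of_pos:
  assumes "\<And>K. pos (1 - of_nat (Suc (2 * K)) * (star (D K) * D K))"
  shows "(\<lambda>K. nrm (app (D K) x)) \<longlonglongrightarrow> 0"
proof -
  have b: "(nrm (app (D K) x))\<^sup>2 \<le> (nrm x)\<^sup>2 * inverse (real (Suc K))" for K
  proof -
    have "0 \<le> ip (app (1 - of_nat (Suc (2 * K)) * (star (D K) * D K)) x) x"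
      using assms[of K] by (simp only: pos_def)
    then have "0 \<le> ip x x - of_nat (Suc (2 * K)) * ip (app (D K) x) (app (D K) x)"
      by (simp only: cs_of_nat[symmetric] app_simps ip_diff_left cs.rep_eq ip_scl_left ip_star_left)
    then have "real (Suc (2 * K)) * (nrm (app (D K) x))\<^sup>2 \<le> (nrm x)\<^sup>2"
      by (simp add: ip_eq_nrm less_eq_complex_def flip: of_real_power)
    moreover have "real (Suc K) * (nrm (app (D K) x))\<^sup>2 \<le> real (Suc (2 * K)) * (nrm (app (D K) x))\<^sup>2"
      by (intro mult_right_mono) auto
    ultimately have "real (Suc K) * (nrm (app (D K) x))\<^sup>2 \<le> (nrm x)\<^sup>2" by linarith
    then show ?thesis by (simp add: field_simps)
  qed
  have "(\<lambda>K. (nrm x)\<^sup>2 * inverse (real (Suc K))) \<longlonglongrightarrow> (nrm x)\<^sup>2 * 0"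
    by (intro tendsto_mult tendsto_const LIMSEQ_inverse_real_of_nat)
  then have l: "(\<lambda>K. (nrm x)\<^sup>2 * inverse (real (Suc K))) \<longlonglongrightarrow> 0"
    by (simp only: mult_zero_right)
  have "(\<lambda>K. (nrm (app (D K) x))\<^sup>2) \<longlonglongrightarrow> 0"
    by (rule real_tendsto_sandwich[OF _ _ tendsto_const l]) (intro always_eventually allI b zero_le_power2)+
  then have "(\<lambda>K. sqrt ((nrm (app (D K) x))\<^sup>2)) \<longlonglongrightarrow> sqrt 0"
    by (intro tendsto_real_sqrt)
  then show ?thesis by simp
qed

text \<open>The coefficient belonging to the exponent \<open>a\<close>; the last branch is meant for
  \<open>a = -1\<close>.\<close>

definition coef :: "'i aop \<Rightarrow> 'i aop \<Rightarrow> int \<Rightarrow> 'i aop" where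
  "coef A B a = (if a = 0 then A else if a = 1 then B else star B)"

text \<open>The difference is 0, \<open>- E K * B\<close> or \<open>- star B * E K\<close> applied
  to \<open>x\<close>, according to the exponent.\<close>

lemma (in toep_pair) coef_tendsto:
  assumes "a \<in> Dexp"
  shows "(\<lambda>K. nrm (app (coef A (A * W K) a) x - app (coef A B a) x)) \<longlonglongrightarrow> 0"
proof -
  have 1: "A * W K = B - E K * B" for K
    by (simp add: W_def A_R left_diff_distrib flip: mult.assoc)
  have neg: "nrm (- y) = nrm y" for y :: "'i ell2"
    by (simp add: nrm_def ip_uminus_left ip_uminus_right)
  have "(\<lambda>K. nrm (app (E K * B) x)) \<longlonglongrightarrow> 0"
    using E_B_small by (rule nrm_tendsto_0_of_pos)
  moreover have "(\<lambda>K. nrm (app (star B * E K) x)) \<longlonglongrightarrow> 0"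
    using star_B_E_small by (rule nrm_tendsto_0_of_pos)
  ultimately show ?thesis
    using assms neg by (auto simp: coef_def 1 Dexp_def) (auto simp: nrm_def)
qed

section \<open>Operator Fejer kernels\<close>

definition geo :: "'i aop \<Rightarrow> nat \<Rightarrow> 'i aop" where
  "geo V j = (\<Sum>i<j. V ^ i)"

text \<open>The sum of the first \<open>N\<close> Dirichlet kernels, left undivided: the
  \<open>m\<close>-th power of \<open>V\<close> occurs with weight \<open>N - m\<close>, and
  likewise its adjoint.\<close>

definition fejer :: "'i aop \<Rightarrow> 'i aop \<Rightarrow> nat \<Rightarrow> 'i aop" where
  "fejer A V N = (\<Sum>j<N. A * geo V (Suc j) + star (geo V (Suc j)) * A - A)"

lemma geo_Suc: "geo V (Suc j) = 1 + V * geo V j"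
  by (simp add: geo_def sum.lessThan_Suc_shift sum_distrib_left del: sum.lessThan_Suc)

lemma star_fejer: "star A = A \<Longrightarrow> star (fejer A V N) = fejer A V N"
  by (simp add: fejer_def add.commute)

text \<open>Subtracting the sandwich of \<open>A\<close> by \<open>geo V N\<close> leaves a
  telescoping sum of the sandwiches of \<open>A - star V * A * V\<close> by
  \<open>geo V j\<close>.\<close>

lemma pos_fejer:
  assumes "star A = A" "pos A" "pos (A - star V * A * V)"
  shows "pos (fejer A V N)"
proof -
  have "pos (fejer A V N - star (geo V N) * A * geo V N)"
  proof (induction N)
    case (Suc N)
    have "fejer A V (Suc N) - star (geo V (Suc N)) * A * geo V (Suc N)
      = (fejer A V N - star (geo V N) * A * geo V N) + star (geo V N) * (A - star V * A * V) * geo V N"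
      by (simp add: fejer_def geo_Suc algebra_simps)
    then show ?case using Suc assms by (simp only: pos_add pos_sandwich)
  qed (simp add: fejer_def geo_def)
  from pos_add[OF this pos_sandwich[OF assms(2), of "geo V N"]] show ?thesis by simp
qed

text \<open>Any upper bound will do, since \<open>Fpos_times\<close> only asks for its existence. It
  comes from the positivity of the sandwich of \<open>A\<close> by \<open>1 - V ^ i\<close>.\<close>

lemma fejer_bounded:
  assumes "star A = A" "pos A" "pos (1 - A)" "pos (A - star V * A * V)"
  shows "\<exists>c. pos (cs (complex_of_real c) - fejer A V N)"
proof -
  have pw: "pos (A - star (V ^ i) * A * V ^ i)" for i
  proof (induction i)
    case (Suc i)
    have "A - star (V ^ Suc i) * A * V ^ Suc i
       = (A - star V * A * V) + star V * (A - star (V ^ i) * A * V ^ i) * V"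
      by (simp add: algebra_simps) (simp add: power_commutes power_Suc2 flip: mult.assoc)
    then show ?case using Suc assms by (simp only: pos_add pos_sandwich)
  qed simp
  have 2: "pos ((A + A) - (A * V ^ i + star (V ^ i) * A))" for i
  proof -
    have "(A + A) - (A * V ^ i + star (V ^ i) * A)
       = star (1 - V ^ i) * A * (1 - V ^ i) + (A - star (V ^ i) * A * V ^ i)"
      by (simp add: algebra_simps)
    then show ?thesis using pw assms by (simp only: pos_add pos_sandwich)
  qed
  have 3: "pos (of_nat j * (A + A) - (A * geo V j + star (geo V j) * A - A))" for j
  proof -
    have "of_nat j * (A + A) - (A * geo V j + star (geo V j) * A - A)
       = (\<Sum>i<j. (A + A) - (A * V ^ i + star (V ^ i) * A)) + A"
      by (simp add: geo_def sum_subtractf sum.distrib sum_distrib_left sum_distrib_right)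
    also have "pos \<dots>" using 2 assms by (intro pos_add pos_sum)
    finally show ?thesis .
  qed
  define m where "m = (\<Sum>j<N. Suc j)"
  have "pos (\<Sum>j<N. of_nat (Suc j) * (A + A) - (A * geo V (Suc j) + star (geo V (Suc j)) * A - A))"
    using 3 by (intro pos_sum)
  also have "(\<Sum>j<N. of_nat (Suc j) * (A + A) - (A * geo V (Suc j) + star (geo V (Suc j)) * A - A))
      = of_nat m * (A + A) - fejer A V N"
    by (simp add: m_def fejer_def sum_subtractf sum.distrib sum_distrib_right del: of_nat_Suc)
  finally have "pos (of_nat m * (A + A) - fejer A V N)" .
  moreover have "pos (of_nat m * ((1 - A) + (1 - A)))"
    using assms by (intro pos_of_nat pos_add)
  ultimately have "pos (of_nat m * (A + A) - fejer A V N + of_nat m * ((1 - A) + (1 - A)))"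
    by (rule pos_add)
  also have "\<dots> = cs (complex_of_real (2 * real m)) - fejer A V N"
  proof -
    have "cs (complex_of_real (2 * real m)) - fejer A V N = cs (complex_of_nat (m + m)) - fejer A V N"
      by simp
    then have "cs (complex_of_real (2 * real m)) - fejer A V N = of_nat m + of_nat m - fejer A V N"
      by (simp only: cs_of_nat of_nat_add cs_add[symmetric])
    then show ?thesis by (simp add: distrib_left right_diff_distrib)
  qed
  finally show ?thesis by blast
qed

section \<open>Commutation with Fejer kernels\<close>

lemma commute_sum:
  fixes S :: "'a::ring_1"
  assumes "\<And>i. i \<in> I \<Longrightarrow> S * f i = f i * S"
  shows "S * (\<Sum>i\<in>I. f i) = (\<Sum>i\<in>I. f i) * S"
  by (simp add: sum_distrib_left sum_distrib_right assms)

lemma commute_mult: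
  fixes S :: "'a::ring_1"
  assumes "S * T = T * S" "S * U = U * S"
  shows "S * (T * U) = T * U * S"
  by (metis assms mult.assoc)

lemma commute_power:
  fixes S :: "'a::ring_1"
  assumes "S * T = T * S"
  shows "S * T ^ k = T ^ k * S"
  by (induction k) (use assms commute_mult in auto)

lemma commute_fejer:
  assumes "S * A = A * S" "S * V = V * S" "S * star V = star V * S"
  shows "S * fejer A V N = fejer A V N * S"
proof -
  have 1: "S * geo V j = geo V j * S" for j
    unfolding geo_def by (intro commute_sum commute_power assms)
  have 2: "S * star (geo V j) = star (geo V j) * S" for j
    unfolding geo_def star_sum star_power by (intro commute_sum commute_power assms)
  show ?thesis unfolding fejer_def
  proof (rule commute_sum)
    fix j
    show "S * (A * geo V (Suc j) + star (geo V (Suc j)) * A - A)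
      = (A * geo V (Suc j) + star (geo V (Suc j)) * A - A) * S"
      using commute_mult[OF assms(1) 1[of "Suc j"]] commute_mult[OF 2[of "Suc j"] assms(1)]
      by (simp add: algebra_simps assms(1))
  qed
qed

text \<open>A geometric sum over the powers of an \<open>M\<close>-th root of unity, which differs
  from 1 because a nonzero \<open>k\<close> with absolute value below \<open>M\<close> is no
  multiple of \<open>M\<close>.\<close>

lemma sum_cis_powi:
  fixes M :: nat and k :: int
  assumes "\<bar>k\<bar> < int M"
  shows "(\<Sum>m<M. cis (2 * pi * real m / real M) powi k) = (if k = 0 then of_nat M else 0)"
proof (cases "k = 0")
  case False
  have M: "M > 0" using assms by linarith
  define x where "x = cis (2 * pi * real_of_int k / real M)"
  have "cis (2 * pi * real m / real M) powi k = x ^ m" for m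
    by (simp add: x_def cis_power_int Complex.DeMoivre mult_ac)
  then have s: "(\<Sum>m<M. cis (2 * pi * real m / real M) powi k) = (\<Sum>m<M. x ^ m)" by simp
  have "x \<noteq> 1"
  proof
    assume "x = 1"
    then have "cos (2 * pi * real_of_int k / real M) = 1"
      by (simp add: x_def complex_eq_iff)
    then obtain n where "2 * pi * real_of_int k / real M = of_int n * 2 * pi"
      using cos_one_2pi_int by auto
    then have "real_of_int k = real_of_int (n * int M)"
      using M by (simp add: field_simps)
    then have "k = n * int M" by (simp only: of_int_eq_iff)
    then show False using assms False by (simp add: abs_mult) 
  qed
  moreover have "x ^ M = 1"
  proof -
    have "real M * (2 * pi * real_of_int k / real M) = 2 * pi * real_of_int k" using M by simp
    then show ?thesis unfolding x_def Complex.DeMoivre by (simp add: cis_multiple_2pi)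
  qed
  ultimately show ?thesis using s False by (simp add: geometric_sum)
qed simp

lemma cs_times_power: "(cs c * W) ^ i = cs (c ^ i) * W ^ i"
proof (induction i)
  case (Suc i)
  have "cs c * W * (cs (c ^ i) * W ^ i) = cs c * (cs (c ^ i) * (W * W ^ i))"
    by (metis cs_commute_left mult.assoc)
  then show ?case using Suc by (simp add: cs_mult_left)
qed simp

text \<open>\<open>Suc N\<close> roots suffice: the exponents in the \<open>N\<close>-th kernel,
  shifted by at most 1, have absolute value at most \<open>N\<close>.\<close>

definition uroot :: "nat \<Rightarrow> nat \<Rightarrow> complex" where
  "uroot N m = cis (2 * pi * real m / real (Suc N))"

text \<open>Averaging against \<open>\<zeta> m powi a\<close> extracts a Fourier coefficient of the
  kernel; the factor \<open>Suc N\<close> is the number of nodes and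
  \<open>N - nat \<bar>a\<bar>\<close> the Fejer weight.\<close>

lemma fejer_average:
  fixes A W :: "'i aop" and N :: nat
  assumes a: "a \<in> Dexp" and A: "star A = A"
  defines "\<zeta> \<equiv> uroot N"
  shows "(\<Sum>m<Suc N. cs (\<zeta> m powi a) * fejer A (cs (cnj (\<zeta> m)) * W) N)
    = cs (of_nat (Suc N) * of_nat (N - nat \<bar>a\<bar>)) * coef A (A * W) a"
proof -
  have nz: "\<zeta> m \<noteq> 0" for m by (simp add: \<zeta>_def uroot_def)
  have c: "cnj (\<zeta> m) = inverse (\<zeta> m)" for m
    by (simp add: \<zeta>_def uroot_def cis_cnj)
  have p1: "\<zeta> m powi a * cnj (\<zeta> m) ^ i = \<zeta> m powi (a - int i)" for m i
    using nz[of m] by (simp add: c power_int_diff power_inverse field_simps)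
  have p2: "\<zeta> m powi a * \<zeta> m ^ i = \<zeta> m powi (a + int i)" for m i
    using nz[of m] by (simp add: power_int_add)
  have 1: "cs (\<zeta> m powi a) * (A * geo (cs (cnj (\<zeta> m)) * W) (Suc j))
      = (\<Sum>i<Suc j. cs (\<zeta> m powi (a - int i)) * (A * W ^ i))" for m j
    unfolding geo_def cs_times_power sum_distrib_left cs_commute_left[of A] cs_mult_left p1 ..
  have 2: "cs (\<zeta> m powi a) * (star (geo (cs (cnj (\<zeta> m)) * W) (Suc j)) * A)
      = (\<Sum>i<Suc j. cs (\<zeta> m powi (a + int i)) * (star W ^ i * A))" for m j
  proof -
    have "star (cs (cnj (\<zeta> m)) * W) = cs (\<zeta> m) * star W" by (simp add: cs_commute)
    then show ?thesis
      unfolding geo_def star_sum star_power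
      by (simp only: cs_times_power sum_distrib_left sum_distrib_right mult.assoc cs_mult_left p2)
  qed
  have z: "(\<Sum>m<Suc N. \<zeta> m powi k) = (if k = 0 then of_nat (Suc N) else 0)" if "\<bar>k\<bar> < int (Suc N)" for k
    unfolding \<zeta>_def uroot_def by (rule sum_cis_powi[OF that])
  let ?M = "cs (of_nat (Suc N)) :: 'i aop"
  have "(\<Sum>m<Suc N. cs (\<zeta> m powi a) * fejer A (cs (cnj (\<zeta> m)) * W) N)
    = (\<Sum>m<Suc N. \<Sum>j<N. (\<Sum>i<Suc j. cs (\<zeta> m powi (a - int i)) * (A * W ^ i))
        + (\<Sum>i<Suc j. cs (\<zeta> m powi (a + int i)) * (star W ^ i * A)) - cs (\<zeta> m powi a) * A)"
    unfolding fejer_def sum_distrib_left[of "cs _"] right_diff_distrib distrib_left 1 2 ..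
  also have "\<dots> = (\<Sum>j<N. \<Sum>m<Suc N. (\<Sum>i<Suc j. cs (\<zeta> m powi (a - int i)) * (A * W ^ i))
        + (\<Sum>i<Suc j. cs (\<zeta> m powi (a + int i)) * (star W ^ i * A)) - cs (\<zeta> m powi a) * A)"
    by (rule sum.swap)
  \<comment> \<open>Orthogonality of the roots keeps \<open>i = a\<close> among the powers of
    \<open>W\<close>, \<open>i = - a\<close> among their adjoints, and the constant term only for
    \<open>a = 0\<close>.\<close>
  also have "\<dots> = (\<Sum>j<N. (\<Sum>i<Suc j. if int i = a then ?M * (A * W ^ i) else 0)
        + (\<Sum>i<Suc j. if int i = - a then ?M * (star W ^ i * A) else 0) - (if a = 0 then ?M * A else 0))"
  proof (rule sum.cong[OF refl])
    fix j assume "j \<in> {..<N}"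
    then have j: "j < N" by simp
    have a1: "\<bar>a\<bar> \<le> 1" using a by (auto simp: Dexp_def)
    have "(\<Sum>m<Suc N. \<Sum>i<Suc j. cs (\<zeta> m powi (a - int i)) * (A * W ^ i))
      = (\<Sum>i<Suc j. cs (\<Sum>m<Suc N. \<zeta> m powi (a - int i)) * (A * W ^ i))"
      unfolding cs_sum sum_distrib_right by (rule sum.swap)
    also have "\<dots> = (\<Sum>i<Suc j. if int i = a then ?M * (A * W ^ i) else 0)"
      by (intro sum.cong refl, subst z) (use j a1 in auto)
    finally have 3: "(\<Sum>m<Suc N. \<Sum>i<Suc j. cs (\<zeta> m powi (a - int i)) * (A * W ^ i)) = \<dots>" .
    have "(\<Sum>m<Suc N. \<Sum>i<Suc j. cs (\<zeta> m powi (a + int i)) * (star W ^ i * A))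
      = (\<Sum>i<Suc j. cs (\<Sum>m<Suc N. \<zeta> m powi (a + int i)) * (star W ^ i * A))"
      unfolding cs_sum sum_distrib_right by (rule sum.swap)
    also have "\<dots> = (\<Sum>i<Suc j. if int i = - a then ?M * (star W ^ i * A) else 0)"
      by (intro sum.cong refl, subst z) (use j a1 in auto)
    finally have 4: "(\<Sum>m<Suc N. \<Sum>i<Suc j. cs (\<zeta> m powi (a + int i)) * (star W ^ i * A)) = \<dots>" .
    have "(\<Sum>m<Suc N. cs (\<zeta> m powi a) * A) = cs (\<Sum>m<Suc N. \<zeta> m powi a) * A"
      unfolding cs_sum sum_distrib_right ..
    also have "\<dots> = (if a = 0 then ?M * A else 0)"
      by (subst z) (use j a1 in auto)
    finally have 5: "(\<Sum>m<Suc N. cs (\<zeta> m powi a) * A) = \<dots>" .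
    show "(\<Sum>m<Suc N. (\<Sum>i<Suc j. cs (\<zeta> m powi (a - int i)) * (A * W ^ i))
        + (\<Sum>i<Suc j. cs (\<zeta> m powi (a + int i)) * (star W ^ i * A)) - cs (\<zeta> m powi a) * A)
      = (\<Sum>i<Suc j. if int i = a then ?M * (A * W ^ i) else 0)
        + (\<Sum>i<Suc j. if int i = - a then ?M * (star W ^ i * A) else 0) - (if a = 0 then ?M * A else 0)"
      unfolding sum_subtractf sum.distrib 3 4 5 ..
  qed
  also have "\<dots> = cs (of_nat (Suc N) * of_nat (N - nat \<bar>a\<bar>)) * coef A (A * W) a"
  proof -
    \<comment> \<open>The Dirichlet kernel with \<open>j = 0\<close> has no first power, whence
      \<open>N - 1\<close>.\<close>
    have cnt: "(\<Sum>j<N. if 0 < j then C else 0) = of_nat (N - 1) * C" for C :: "'i aop"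
      by (induction N) (auto simp: of_nat_diff algebra_simps split: nat.splits)
    have s: "(\<Sum>i<Suc j. if int i = c then G i else 0)
      = (if 0 \<le> c \<and> c \<le> int j then G (nat c) else 0)" for j c and G :: "nat \<Rightarrow> 'i aop"
    proof -
      have "(\<Sum>i<Suc j. if int i = c then G i else 0) = (\<Sum>i<Suc j. if nat c = i then if 0 \<le> c then G i else 0 else 0)"
        by (intro sum.cong refl) auto
      then show ?thesis by (auto simp: sum.delta)
    qed
    consider "a = 0" | "a = 1" | "a = -1" using a by (auto simp: Dexp_def)
    then show ?thesis
    proof cases
      case 1
      then show ?thesis
        unfolding s by (simp add: coef_def cs_mult_left mult.commute flip: cs_of_nat)
    next
      case 2
      then have "(\<Sum>j<N. (if 0 \<le> a \<and> a \<le> int j then ?M * (A * W ^ nat a) else 0)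
        + (if 0 \<le> - a \<and> - a \<le> int j then ?M * (star W ^ nat (- a) * A) else 0) - (if a = 0 then ?M * A else 0))
        = (\<Sum>j<N. if 0 < j then ?M * (A * W) else 0)"
        by (intro sum.cong refl) auto
      then show ?thesis unfolding s cnt using 2
        by (simp add: coef_def cs_mult_left mult.commute flip: cs_of_nat)
    next
      case 3
      then have "(\<Sum>j<N. (if 0 \<le> a \<and> a \<le> int j then ?M * (A * W ^ nat a) else 0)
        + (if 0 \<le> - a \<and> - a \<le> int j then ?M * (star W ^ nat (- a) * A) else 0) - (if a = 0 then ?M * A else 0))
        = (\<Sum>j<N. if 0 < j then ?M * (star W * A) else 0)"
        by (intro sum.cong refl) auto
      then show ?thesis unfolding s cnt using 3 A
        by (simp add: coef_def cs_mult_left mult.commute flip: cs_of_nat)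
    qed
  qed
  finally show ?thesis .
qed

lemma sum_swap_inward:
  "(\<Sum>p\<in>I. \<Sum>r\<in>J. \<Sum>s\<in>K. \<Sum>a\<in>L. \<Sum>b\<in>M. g p r s a b)
    = (\<Sum>r\<in>J. \<Sum>s\<in>K. \<Sum>a\<in>L. \<Sum>b\<in>M. \<Sum>p\<in>I. g p r s a b)"
  by (intro trans[OF sum.swap sum.cong[OF refl]] sum.swap)

lemma uroot_norm [simp]: "cmod (uroot N m) = 1" by (simp add: uroot_def)

text \<open>The adjoints are included because \<open>star B\<close> corresponds to the exponent
  -1.\<close>

definition commuting_pairs :: "'i aop \<Rightarrow> 'i aop \<Rightarrow> 'i aop \<Rightarrow> 'i aop \<Rightarrow> bool" where
  "commuting_pairs A B A' B' \<longleftrightarrow>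
     (\<forall>S \<in> {A, B, star B}. \<forall>T \<in> {A', B', star B'}. S * T = T * S)"

lemma (in toep_pair) commute_W:
  assumes "S * A = A * S" "S * B = B * S"
  shows "S * W K = W K * S"
proof -
  have "S * (1 - A) = (1 - A) * S" using assms by (simp add: algebra_simps)
  then have "S * R K = R K * S" unfolding R_def by (intro commute_sum commute_power)
  then show ?thesis unfolding W_def using assms by (intro commute_mult)
qed

lemma (in toep_pair) commute_star_W:
  assumes "S * A = A * S" "S * star B = star B * S"
  shows "S * star (W K) = star (W K) * S"
proof -
  have "star S * A = A * star S" "star S * B = B * star S"
    using arg_cong[OF assms(1), of star] arg_cong[OF assms(2), of star] by auto
  then have "star S * W K = W K * star S" by (rule commute_W)
  from arg_cong[OF this, of star] show ?thesis by simp
qed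

lemma (in toep_pair) commute_fejer_W:
  assumes "S * A = A * S" "S * B = B * S" "S * star B = star B * S"
  shows "S * fejer A (cs c * W K) N = fejer A (cs c * W K) N * S"
proof (rule commute_fejer)
  show "S * (cs c * W K) = cs c * W K * S"
    by (intro commute_mult commute_W assms) (simp add: cs_commute)
  have "S * (star (W K) * cs (cnj c)) = star (W K) * cs (cnj c) * S"
    by (intro commute_mult commute_star_W assms) (simp add: cs_commute)
  then show "S * star (cs c * W K) = star (cs c * W K) * S" by simp
qed (rule assms)

lemma (in toep_pair) fejer_W:
  assumes "cmod c = 1"
  shows "star (fejer A (cs c * W K) N) = fejer A (cs c * W K) N"
    and "pos (fejer A (cs c * W K) N)"
    and "\<exists>d. pos (cs (complex_of_real d) - fejer A (cs c * W K) N)"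
proof -
  have "c * cnj c = 1" using assms by (simp add: complex_norm_square[symmetric])
  then have "star (cs c * W K) * A * (cs c * W K) = star (W K) * A * W K"
    by (simp add: mult.assoc cs_commute_left[of A] cs_mult_left mult.commute)
  then have 1: "pos (A - star (cs c * W K) * A * (cs c * W K))"
    using contraction by simp
  show "star (fejer A (cs c * W K) N) = fejer A (cs c * W K) N"
    by (simp add: star_fejer)
  show "pos (fejer A (cs c * W K) N)"
    by (intro pos_fejer pos_A star_A 1)
  show "\<exists>d. pos (cs (complex_of_real d) - fejer A (cs c * W K) N)"
    by (intro fejer_bounded pos_A star_A A_le_1 1)
qed

text \<open>Up to the factor \<open>(Suc N)^2\<close> the form is the sum over pairs of nodes of the
  value of \<open>X\<close> there, weighted by the product of the commuting positive operators
  \<open>P m\<close> and \<open>Q l\<close>.\<close>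

lemma averaged_form_nonneg:
  fixes A B A' B' :: "'i aop" and K N :: nat
  assumes p: "toep_pair A B" and q: "toep_pair A' B'" and c: "commuting_pairs A B A' B'"
    and X: "min_pos n X"
  defines "W1 \<equiv> toep_pair.W A B K" and "W2 \<equiv> toep_pair.W A' B' K"
  shows "0 \<le> (\<Sum>r<n. \<Sum>s<n. \<Sum>a\<in>Dexp. \<Sum>b\<in>Dexp. X a b r s *
     (of_nat (N - nat \<bar>a\<bar>) * of_nat (N - nat \<bar>b\<bar>) *
       ip (app (coef A (A * W1) a * coef A' (A' * W2) b) (h s)) (h r)))"
proof -
  interpret p: toep_pair A B by (rule p)
  interpret q: toep_pair A' B' by (rule q)
  let ?z = "uroot N"
  define P where "P m = fejer A (cs (cnj (?z m)) * W1) N" for m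
  define Q where "Q m = fejer A' (cs (cnj (?z m)) * W2) N" for m
  let ?M = "{..<Suc N}"
  define Z where "Z = (\<Sum>r<n. \<Sum>s<n. \<Sum>a\<in>Dexp. \<Sum>b\<in>Dexp. X a b r s *
     (of_nat (N - nat \<bar>a\<bar>) * of_nat (N - nat \<bar>b\<bar>) *
       ip (app (coef A (A * W1) a * coef A' (A' * W2) b) (h s)) (h r)))"
  have SP: "S * P m = P m * S" if "S \<in> {A', B', star B'}" for S m
    using c that unfolding P_def W1_def commuting_pairs_def by (intro p.commute_fejer_W) auto
  have QP: "P m * Q l = Q l * P m" for m l
    unfolding Q_def W2_def using SP by (intro q.commute_fejer_W) auto
  have "0 \<le> (\<Sum>r<n. \<Sum>s<n. (\<Sum>a\<in>Dexp. \<Sum>b\<in>Dexp. X a b r s * ?z m powi a * ?z l powi b)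
      * ip (app (P m * Q l) (h s)) (h r))" for m l
  proof -
    define F where "F r s = (\<Sum>a\<in>Dexp. \<Sum>b\<in>Dexp. X a b r s * ?z m powi a * ?z l powi b)" for r s
    have "psd n F"
      using X unfolding min_pos_def F_def by simp
    then have f1: "Fpos n F (1 :: 'i aop)" by (rule Fpos_one)
    have u: "cmod (cnj (?z j)) = 1" for j by simp
    obtain d where d: "pos (cs (complex_of_real d) - Q l)"
      using q.fejer_W(3)[OF u] unfolding Q_def W2_def by blast
    \<comment> \<open>The weights are multiplied on one at a time, starting from the
      identity.\<close>
    have "Fpos n F (Q l * 1)"
      by (rule Fpos_times[OF _ _ d _ f1])
         (auto simp: Q_def W2_def q.fejer_W[OF u])
    then have f2: "Fpos n F (Q l)" by simp
    obtain d where d: "pos (cs (complex_of_real d) - P m)"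
      using p.fejer_W(3)[OF u] unfolding P_def W1_def by blast
    have "Fpos n F (P m * Q l)"
    proof (rule Fpos_times[OF _ _ d QP f2])
      show "star (P m) = P m" "pos (P m)"
        unfolding P_def W1_def by (rule p.fejer_W[OF u])+
    qed
    then show ?thesis unfolding Fpos_def F_def by (rule spec)
  qed
  then have "0 \<le> (\<Sum>(m, l)\<in>?M \<times> ?M. \<Sum>r<n. \<Sum>s<n. 
      (\<Sum>a\<in>Dexp. \<Sum>b\<in>Dexp. X a b r s * ?z m powi a * ?z l powi b) * ip (app (P m * Q l) (h s)) (h r))"
    by (intro sum_nonneg) (auto simp del: app_simps)
  also have "\<dots> = (\<Sum>p\<in>?M \<times> ?M. \<Sum>r<n. \<Sum>s<n. \<Sum>a\<in>Dexp. \<Sum>b\<in>Dexp.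
      X a b r s * (?z (fst p) powi a * ?z (snd p) powi b * ip (app (P (fst p) * Q (snd p)) (h s)) (h r)))"
    by (simp only: case_prod_unfold sum_distrib_right mult.assoc)
  also have "\<dots> = (\<Sum>r<n. \<Sum>s<n. \<Sum>a\<in>Dexp. \<Sum>b\<in>Dexp. \<Sum>p\<in>?M \<times> ?M.
      X a b r s * (?z (fst p) powi a * ?z (snd p) powi b * ip (app (P (fst p) * Q (snd p)) (h s)) (h r)))"
    by (rule sum_swap_inward)
  also have "\<dots> = (\<Sum>r<n. \<Sum>s<n. \<Sum>a\<in>Dexp. \<Sum>b\<in>Dexp. (of_nat (Suc N))\<^sup>2 * (X a b r s *
     (of_nat (N - nat \<bar>a\<bar>) * of_nat (N - nat \<bar>b\<bar>) *
       ip (app (coef A (A * W1) a * coef A' (A' * W2) b) (h s)) (h r))))"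
  proof (intro sum.cong refl)
    fix r s a b assume ab: "a \<in> Dexp" "b \<in> Dexp"
    \<comment> \<open>The double average factors into one average for each variable.\<close>
    have "(\<Sum>p\<in>?M \<times> ?M. cs (?z (fst p) powi a) * P (fst p) * (cs (?z (snd p) powi b) * Q (snd p)))
      = (\<Sum>m\<in>?M. cs (?z m powi a) * P m) * (\<Sum>l\<in>?M. cs (?z l powi b) * Q l)"
      unfolding sum_product sum.cartesian_product by (simp only: case_prod_unfold)
    also have "\<dots> = cs (of_nat (Suc N) * of_nat (N - nat \<bar>a\<bar>)) * coef A (A * W1) a
        * (cs (of_nat (Suc N) * of_nat (N - nat \<bar>b\<bar>)) * coef A' (A' * W2) b)"
      unfolding P_def Q_def using ab by (simp only: fejer_average p.star_A q.star_A)
    finally have e: "(\<Sum>p\<in>?M \<times> ?M. cs (?z (fst p) powi a) * P (fst p) * (cs (?z (snd p) powi b) * Q (snd p)))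
      = \<dots>" .
    have cc: "cs u * S * (cs v * T) = cs (u * v) * (S * T)" for u v and S T :: "'i aop"
      by (simp only: mult.assoc cs_commute_left[of S] cs_mult_left)
    have "(\<Sum>p\<in>?M \<times> ?M. ?z (fst p) powi a * ?z (snd p) powi b * ip (app (P (fst p) * Q (snd p)) (h s)) (h r))
      = ip (app (\<Sum>p\<in>?M \<times> ?M. cs (?z (fst p) powi a) * P (fst p) * (cs (?z (snd p) powi b) * Q (snd p))) (h s)) (h r)"
      unfolding cc app_sum ip_sum_left ip_cs ..
    also have "\<dots> = (of_nat (Suc N) * of_nat (N - nat \<bar>a\<bar>)) * (of_nat (Suc N) * of_nat (N - nat \<bar>b\<bar>)) *
       ip (app (coef A (A * W1) a * coef A' (A' * W2) b) (h s)) (h r)"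
      unfolding e unfolding cc ip_cs ..
    finally show "(\<Sum>p\<in>?M \<times> ?M. X a b r s * (?z (fst p) powi a * ?z (snd p) powi b * ip (app (P (fst p) * Q (snd p)) (h s)) (h r)))
      = (of_nat (Suc N))\<^sup>2 * (X a b r s * (of_nat (N - nat \<bar>a\<bar>) * of_nat (N - nat \<bar>b\<bar>) *
       ip (app (coef A (A * W1) a * coef A' (A' * W2) b) (h s)) (h r)))"
      by (simp only: sum_distrib_left[symmetric] power2_eq_square mult_ac)
  qed
  also have "\<dots> = (of_nat (Suc N))\<^sup>2 * Z"
    unfolding Z_def sum_distrib_left ..
  finally have "0 \<le> (of_nat (Suc N))\<^sup>2 * Z" .
  moreover have "0 \<le> complex_of_real (inverse ((real (Suc N))\<^sup>2))"
    by (simp add: less_eq_complex_def)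
  ultimately have "0 \<le> of_real (inverse ((real (Suc N))\<^sup>2)) * ((of_nat (Suc N))\<^sup>2 * Z)"
    by (rule mult_nonneg_nonneg[rotated])
  also have "of_real (inverse ((real (Suc N))\<^sup>2)) * ((of_nat (Suc N))\<^sup>2 * Z) = Z"
  proof -
    have "of_real (inverse ((real (Suc N))\<^sup>2)) * (of_nat (Suc N))\<^sup>2 = (1::complex)"
      by (simp del: of_nat_Suc)
    then show ?thesis by (simp only: mult.assoc[symmetric] mult_1_left)
  qed
  finally show ?thesis unfolding Z_def .
qed

lemma star_coef: "star A = A \<Longrightarrow> a \<in> Dexp \<Longrightarrow> star (coef A B a) = coef A B (- a)"
  by (auto simp: coef_def Dexp_def)

text \<open>A single limit suffices: the parameter \<open>K\<close> governs both the Neumann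
  truncation and the Fejer degree \<open>Suc K\<close>.\<close>

lemma commuting_form_nonneg:
  fixes A B A' B' :: "'i aop"
  assumes p: "toep_pair A B" and q: "toep_pair A' B'" and c: "commuting_pairs A B A' B'"
    and X: "min_pos n X"
  shows "0 \<le> (\<Sum>r<n. \<Sum>s<n. \<Sum>a\<in>Dexp. \<Sum>b\<in>Dexp. X a b r s *
       ip (app (coef A B a * coef A' B' b) (h s)) (h r))"
proof -
  interpret p: toep_pair A B by (rule p)
  interpret q: toep_pair A' B' by (rule q)
  let ?P = "\<lambda>K a. coef A (A * p.W K) a" and ?Q = "\<lambda>K b. coef A' (A' * q.W K) b"
  define w where "w K a = complex_of_nat (Suc K - nat \<bar>a\<bar>) / of_nat (Suc K)" for K :: nat and a :: int
  define f where "f K = (\<Sum>r<n. \<Sum>s<n. \<Sum>a\<in>Dexp. \<Sum>b\<in>Dexp. X a b r s *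
     (w K a * w K b * ip (app (?P K a * ?Q K b) (h s)) (h r)))" for K
  have "f \<longlonglongrightarrow> (\<Sum>r<n. \<Sum>s<n. \<Sum>a\<in>Dexp. \<Sum>b\<in>Dexp. X a b r s *
     (1 * 1 * ip (app (coef A B a * coef A' B' b) (h s)) (h r)))"
    unfolding f_def
  proof (intro tendsto_sum tendsto_mult tendsto_const)
    fix r s and a b :: int assume ab: "a \<in> Dexp" "b \<in> Dexp"
    have w1: "(\<lambda>K. w K c) \<longlonglongrightarrow> 1" if "c \<in> Dexp" for c
    proof (cases "c = 0")
      case True
      then show ?thesis by (simp add: w_def del: of_nat_Suc)
    next
      case False
      then have "w K c = of_nat K / of_nat (Suc K)" for K
        using that by (auto simp: w_def Dexp_def)
      then show ?thesis using LIMSEQ_n_over_Suc_n[where 'a = complex] by (simp only:)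
    qed
    show "(\<lambda>K. w K a) \<longlonglongrightarrow> 1" "(\<lambda>K. w K b) \<longlonglongrightarrow> 1" by (intro w1 ab)+
    have na: "- a \<in> Dexp" using ab by (auto simp: Dexp_def)
    \<comment> \<open>With the left factor moved across, each argument is one strongly convergent
      sequence of vectors, so the convergence of products of operators is not at issue.\<close>
    have st: "ip (app (S * T) x) y = ip (app T x) (app (star S) y)" for S T :: "'i aop" and x y
      by (simp add: ip_star_right)
    have "(\<lambda>K. ip (app (?Q K b) (h s)) (app (?P K (- a)) (h r)))
      \<longlonglongrightarrow> ip (app (coef A' B' b) (h s)) (app (coef A B (- a)) (h r))"
      by (intro ip_tendsto p.coef_tendsto q.coef_tendsto ab na)
    then show "(\<lambda>K. ip (app (?P K a * ?Q K b) (h s)) (h r))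
      \<longlonglongrightarrow> ip (app (coef A B a * coef A' B' b) (h s)) (h r)"
      unfolding st by (simp only: star_coef p.star_A ab)
  qed
  moreover have "0 \<le> f K" for K
  proof -
    let ?N = "Suc K"
    have "0 \<le> of_real (inverse ((real ?N)\<^sup>2)) * (\<Sum>r<n. \<Sum>s<n. \<Sum>a\<in>Dexp. \<Sum>b\<in>Dexp. X a b r s *
     (of_nat (?N - nat \<bar>a\<bar>) * of_nat (?N - nat \<bar>b\<bar>) *
       ip (app (?P K a * ?Q K b) (h s)) (h r)))"
      by (intro mult_nonneg_nonneg averaged_form_nonneg[OF p q c X])
         (auto simp: less_eq_complex_def simp del: of_nat_Suc)
    also have "\<dots> = f K"
      unfolding f_def w_def sum_distrib_left
      by (intro sum.cong refl) (simp add: divide_inverse power2_eq_square del: of_nat_Suc app_simps)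
    finally show ?thesis .
  qed
  ultimately show ?thesis
    using complex_nonneg_limit by (simp only: mult_1_left)
qed

section \<open>Commuting completely positive maps\<close>

lemma scl_add: "scl c (x + y) = scl c x + scl c y"
  by (rule ip_ext) (simp add: ip_scl_left ip_add_left distrib_left)

lemma scl_scl: "scl c (scl d x) = scl (c * d) x"
  by (rule ip_ext) (simp add: ip_scl_left)

lemma scl_one [simp]: "scl 1 x = x"
  by (rule ip_ext) (simp add: ip_scl_left)

lemma scl_zero [simp]: "scl 0 x = 0"
  by (rule ip_ext) (simp add: ip_scl_left)

lemma scl_eq_iff: "c \<noteq> 0 \<Longrightarrow> scl c x = scl c y \<longleftrightarrow> x = y"
  by (metis scl_scl scl_one left_inverse)

text \<open>What is extracted from complete positivity: linearity, positivity at the single element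
  \<open>toep_elem\<close>, and an upper bound for the image of 1.\<close>

definition toep_map :: "(int \<Rightarrow> 'i ell2 \<Rightarrow> 'i ell2) \<Rightarrow> bool" where
  "toep_map f \<longleftrightarrow>
     (\<forall>a\<in>Dexp. \<forall>x y c. f a (x + y) = f a x + f a y \<and> f a (scl c x) = scl c (f a x)) \<and>
     (\<forall>x y. 0 \<le> ip (f 0 x) x + ip (f 0 y) y + ip (f 1 y) x + ip (f (-1) x) y) \<and>
     (\<exists>C. \<forall>x. Re (ip (f 0 x) x) \<le> C * Re (ip x x))"

text \<open>Polarisation: the forms are real, and inserting the factor \<open>\<i>\<close> in one
  argument separates real and imaginary parts.\<close>

lemma toep_map_adjoint:
  assumes "toep_map f"
  shows "ip (f 0 x) y = ip x (f 0 y)" and "ip (f 1 x) y = ip x (f (-1) y)"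
proof -
  have D: "0 \<in> Dexp" "1 \<in> Dexp" "-1 \<in> Dexp" by (auto simp: Dexp_def)
  have lin: "f a (u + v) = f a u + f a v" "f a (scl c u) = scl c (f a u)" if "a \<in> Dexp" for a u v c
    using assms that by (auto simp: toep_map_def)
  have Q: "0 \<le> ip (f 0 u) u + ip (f 0 v) v + ip (f 1 v) u + ip (f (-1) u) v" for u v
    using assms by (auto simp: toep_map_def)
  have f0: "f a 0 = 0" if "a \<in> Dexp" for a using lin(2)[OF that, of 0 0] by simp
  have r: "Im (ip (f 0 u) u) = 0" for u
    using Q[of u 0] by (simp add: f0 D less_eq_complex_def)
  have "ip (f 0 y) x = cnj (ip (f 0 x) y)"
    using r[of "x + y"] r[of "x + scl \<i> y"] r[of x] r[of y]
    by (simp add: lin D ip_add_left ip_add_right ip_scl_left ip_scl_right complex_eq_iff)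
  then show "ip (f 0 x) y = ip x (f 0 y)" by (metis ip_cnj complex_cnj_cnj)
  have "ip (f (-1) y) x = cnj (ip (f 1 x) y)"
    using Q[of y x] Q[of y "scl \<i> x"] r[of x] r[of y] r[of "scl \<i> x"]
    by (simp add: lin D ip_add_left ip_add_right ip_scl_left ip_scl_right complex_eq_iff less_eq_complex_def)
  then show "ip (f 1 x) y = ip x (f (-1) y)" by (metis ip_cnj complex_cnj_cnj)
qed

lemma toep_map_toep_pair:
  assumes f: "toep_map f"
  shows "\<exists>c A B. c \<noteq> 0 \<and> 0 \<le> c \<and> toep_pair A B \<and>
    (\<forall>a\<in>Dexp. \<forall>x. f a x = scl c (app (coef A B a) x))"
proof -
  note adj = toep_map_adjoint[OF f]
  obtain C where C: "\<And>x. Re (ip (f 0 x) x) \<le> C * Re (ip x x)"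
    using f by (auto simp: toep_map_def)
  have Q: "0 \<le> ip (f 0 u) u + ip (f 0 v) v + ip (f 1 v) u + ip (f (-1) u) v" for u v
    using f by (auto simp: toep_map_def)
  have adj': "ip (f (-1) x) y = ip x (f 1 y)" for x y
    by (metis adj(2) ip_cnj)
  \<comment> \<open>Dividing by this positive bound for \<open>f 0\<close> achieves the
    normalisation of \<open>toep_pair\<close>.\<close>
  define d where "d = max C 1"
  have d: "d > 0" "C \<le> d" by (auto simp: d_def)
  define A0 where "A0 = Abs_aop (f 0)"
  define B0 where "B0 = Abs_aop (f 1)"
  have A0: "app A0 = f 0" unfolding A0_def using adj by (intro Abs_aop_inverse) auto
  have B0: "app B0 = f 1" unfolding B0_def using adj by (intro Abs_aop_inverse) auto
  have sA0: "star A0 = A0" by (rule star_unique) (simp add: A0 adj)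
  have sB0: "app (star B0) x = f (-1) x" for x
    by (rule ip_ext) (simp add: ip_star_left B0 adj')
  define e where "e = complex_of_real (1 / d)"
  have e: "0 \<le> e" "cnj e = e" using d by (auto simp: e_def less_eq_complex_def)
  have star_e: "star (cs e * T) = cs e * star T" for T :: "'a aop" by (simp add: cs_commute e)
  have tp: "toep_pair (cs e * A0) (cs e * B0)"
  proof
    show "star (cs e * A0) = cs e * A0" by (simp only: star_e sA0)
    fix x y
    have "0 \<le> e * (ip (f 0 x) x + ip (f 0 y) y + ip (f 1 y) x + ip (f (-1) x) y)"
      by (intro mult_nonneg_nonneg Q e)
    then show "0 \<le> ip (app (cs e * A0) x) x + ip (app (cs e * A0) y) y
        + ip (app (cs e * B0) y) x + ip (app (star (cs e * B0)) x) y"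
      by (simp add: star_e cs.rep_eq ip_scl_left A0 B0 sB0 distrib_left del: star_mult)
  next
    show "pos (1 - cs e * A0)"
      unfolding pos_def
    proof
      fix x
      have "Im (ip (f 0 x) x) = 0"
        using ip_cnj[of x "f 0 x"] adj(1)[of x x] by (simp add: complex_eq_iff)
      moreover have "Re (ip (f 0 x) x) \<le> d * Re (ip x x)"
        using C[of x] d(2) ip_nonneg[of x] by (smt (verit) mult_right_mono less_eq_complex_def zero_complex.sel)
      ultimately show "0 \<le> ip (app (1 - cs e * A0) x) x"
        using d(1) ip_nonneg[of x]
        by (simp add: ip_diff_left cs.rep_eq ip_scl_left A0 less_eq_complex_def e_def field_simps)
    qed
  qed
  have de: "complex_of_real d * e = 1" using d by (simp add: e_def)
  show ?thesis
  proof (intro exI conjI ballI allI)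
    show "toep_pair (cs e * A0) (cs e * B0)" by (rule tp)
    show "complex_of_real d \<noteq> 0" "0 \<le> complex_of_real d"
      using d by (auto simp: less_eq_complex_def)
    fix a x assume "a \<in> Dexp"
    then show "f a x = scl (complex_of_real d) (app (coef (cs e * A0) (cs e * B0) a) x)"
      using de by (auto simp: star_e Dexp_def coef_def cs.rep_eq scl_scl A0 B0 sB0 simp del: star_mult)
  qed
qed

lemma commuting_toep_maps_nonneg:
  assumes f: "toep_map f" and g: "toep_map g"
    and c: "\<And>a b x. a \<in> Dexp \<Longrightarrow> b \<in> Dexp \<Longrightarrow> f a (g b x) = g b (f a x)"
    and X: "min_pos n X"
  shows "0 \<le> (\<Sum>r<n. \<Sum>s<n. \<Sum>a\<in>Dexp. \<Sum>b\<in>Dexp. X a b r s * ip (f a (g b (h s))) (h r))"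
proof -
  obtain u A B where 1: "u \<noteq> 0" "0 \<le> u" "toep_pair A B"
    "\<And>a x. a \<in> Dexp \<Longrightarrow> f a x = scl u (app (coef A B a) x)"
    using toep_map_toep_pair[OF f] by blast
  obtain v A' B' where 2: "v \<noteq> 0" "0 \<le> v" "toep_pair A' B'"
    "\<And>a x. a \<in> Dexp \<Longrightarrow> g a x = scl v (app (coef A' B' a) x)"
    using toep_map_toep_pair[OF g] by blast
  have fg: "f a (g b x) = scl (u * v) (app (coef A B a * coef A' B' b) x)"
    "g b (f a x) = scl (u * v) (app (coef A' B' b * coef A B a) x)"
    if "a \<in> Dexp" "b \<in> Dexp" for a b x
    using that by (auto simp: 1 2 app_scl scl_scl mult.commute)
  have cm: "coef A B a * coef A' B' b = coef A' B' b * coef A B a" if "a \<in> Dexp" "b \<in> Dexp" for a b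
  proof (rule aop_eqI)
    fix x y
    have "app (coef A B a * coef A' B' b) x = app (coef A' B' b * coef A B a) x"
      using c[OF that, of x] 1(1) 2(1) unfolding fg[OF that] by (simp add: scl_eq_iff)
    then show "ip (app (coef A B a * coef A' B' b) x) y = ip (app (coef A' B' b * coef A B a) x) y"
      by simp
  qed
  have "commuting_pairs A B A' B'"
    using cm[of 0 0] cm[of 0 1] cm[of 0 "-1"] cm[of 1 0] cm[of 1 1] cm[of 1 "-1"]
      cm[of "-1" 0] cm[of "-1" 1] cm[of "-1" "-1"]
    by (auto simp: commuting_pairs_def coef_def Dexp_def)
  from commuting_form_nonneg[OF 1(3) 2(3) this X]
  have "0 \<le> (u * v) * (\<Sum>r<n. \<Sum>s<n. \<Sum>a\<in>Dexp. \<Sum>b\<in>Dexp. X a b r s *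
       ip (app (coef A B a * coef A' B' b) (h s)) (h r))"
    using 1(2) 2(2) by (intro mult_nonneg_nonneg)
  also have "\<dots> = (\<Sum>r<n. \<Sum>s<n. \<Sum>a\<in>Dexp. \<Sum>b\<in>Dexp. X a b r s * ip (f a (g b (h s))) (h r))"
    unfolding sum_distrib_left
    by (intro sum.cong refl) (simp add: fg ip_scl_left del: app_simps)
  finally show ?thesis .
qed

text \<open>Positivity at one element already gives complete positivity. The partner
  \<open>g\<close> sends 1 to the identity and the other two generators to 0, so it commutes with
  everything.\<close>

lemma toep_map_nonneg:
  assumes f: "toep_map f" and P: "S1_pos k P"
  shows "0 \<le> (\<Sum>i<k. \<Sum>j<k. \<Sum>a\<in>Dexp. P a i j * ip (f a (h j)) (h i))"
proof -
  define g :: "int \<Rightarrow> 'a ell2 \<Rightarrow> 'a ell2" where "g b x = (if b = 0 then x else 0)" for b x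
  define X where "X a b = (if b = 0 then P a else (\<lambda>_ _. 0))" for a b :: int
  have g: "toep_map g"
    unfolding toep_map_def g_def
    by (auto intro!: exI[of _ 1] add_nonneg_nonneg ip_nonneg simp: scl_add)
       (metis add_cancel_right_right scl_add scl_zero scl_scl mult_zero_left mult_zero_right)+
  have f0: "f a 0 = 0" if "a \<in> Dexp" for a
  proof -
    have "f a (scl 0 0) = scl 0 (f a 0)" using f that unfolding toep_map_def by blast
    then show ?thesis by simp
  qed
  have "min_pos k X"
    using P by (simp add: min_pos_def S1_pos_def X_def Dexp_def)
  then have "0 \<le> (\<Sum>r<k. \<Sum>s<k. \<Sum>a\<in>Dexp. \<Sum>b\<in>Dexp. X a b r s * ip (f a (g b (h s))) (h r))"
    using f0 by (intro commuting_toep_maps_nonneg f g) (auto simp: g_def)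
  then show ?thesis by (simp add: X_def g_def Dexp_def)
qed

section \<open>Passage from maps on square-summable functions to \<open>ell2\<close>\<close>

lemma l2inner_coord: "f \<in> l2 \<Longrightarrow> g \<in> l2 \<Longrightarrow> l2inner f g = ip (Abs_ell2 f) (Abs_ell2 g)"
  by (simp add: ip.rep_eq Abs_ell2_inverse)

lemma l2norm_coord: "l2norm (coord x) = nrm x"
  using ip_eq_infsum_cmod[of x] by (simp add: l2norm_def nrm_def)

definition lift_op :: "(('i \<Rightarrow> complex) \<Rightarrow> ('i \<Rightarrow> complex)) \<Rightarrow> 'i ell2 \<Rightarrow> 'i ell2" where
  "lift_op T x = Abs_ell2 (T (coord x))"

lemma coord_lift_op: "bounded_op T \<Longrightarrow> coord (lift_op T x) = T (coord x)"
  using coord[of x] by (simp add: lift_op_def bounded_op_def Abs_ell2_inverse)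

lemma mult_cnj_nonneg: "0 \<le> w * cnj w" for w :: complex
  by (simp add: less_eq_complex_def)

text \<open>The matrix over the circle with rows \<open>1, z\<close> and
  \<open>inverse z, 1\<close>.\<close>

definition toep_elem :: "int \<Rightarrow> cmat" where
  "toep_elem a i j = (if a = int j - int i then 1 else 0)"

lemma S1_pos_toep_elem: "S1_pos 2 toep_elem"
  unfolding S1_pos_def psd_def
proof (intro allI impI)
  fix z :: complex and v :: "nat \<Rightarrow> complex"
  assume "cmod z = 1"
  then have z: "z * cnj z = 1" "inverse z = cnj z"
    by (auto simp: complex_norm_square[symmetric] inverse_complex_def cnj.code Re_divide_numeral
        complex_eq_iff cmod_def power2_eq_square)
  have "(\<Sum>i<2. \<Sum>j<2. cnj (v i) * (\<Sum>a\<in>Dexp. toep_elem a i j * z powi a) * v j)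
    = (v 0 + z * v 1) * cnj (v 0 + z * v 1)"
    using z by (simp add: numeral_2_eq_2 Dexp_def toep_elem_def algebra_simps)
  also have "\<dots> \<ge> 0" by (rule mult_cnj_nonneg)
  finally show "0 \<le> (\<Sum>i<2. \<Sum>j<2. cnj (v i) * (\<Sum>a\<in>Dexp. toep_elem a i j * z powi a) * v j)" .
qed

lemma cp_S1_toep_map:
  assumes "cp_S1 \<Phi>"
  shows "toep_map (\<lambda>a. lift_op (\<Phi> a))"
proof -
  have b: "bounded_op (\<Phi> a)" if "a \<in> Dexp" for a
    using assms that by (auto simp: cp_S1_def)
  have D: "0 \<in> Dexp" "1 \<in> Dexp" "-1 \<in> Dexp" by (auto simp: Dexp_def)
  have lin: "lift_op (\<Phi> a) (x + y) = lift_op (\<Phi> a) x + lift_op (\<Phi> a) y"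
     "lift_op (\<Phi> a) (scl c x) = scl c (lift_op (\<Phi> a) x)" if "a \<in> Dexp" for a x y c
    using b[OF that] coord[of x] coord[of y]
    by (auto simp: coord_lift_op[OF b[OF that]] plus_ell2.rep_eq scl.rep_eq bounded_op_def
        simp flip: coord_inject)
  have "op_psd 2 (\<lambda>i j f t. \<Sum>a\<in>Dexp. toep_elem a i j * \<Phi> a f t)"
    using assms S1_pos_toep_elem by (auto simp: cp_S1_def)
  then have Q: "0 \<le> (\<Sum>r<2. \<Sum>s<2. l2inner (\<lambda>t. \<Sum>a\<in>Dexp. toep_elem a r s * \<Phi> a (coord (h s)) t) (coord (h r)))"
    for h :: "nat \<Rightarrow> 'a ell2"
    unfolding op_psd_def using coord by (auto dest!: spec[where x = "\<lambda>r. coord (h r)"])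
  have Q': "0 \<le> ip (lift_op (\<Phi> 0) x) x + ip (lift_op (\<Phi> 0) y) y + ip (lift_op (\<Phi> 1) y) x + ip (lift_op (\<Phi> (-1)) x) y" for x y
    using Q[of "\<lambda>i. if i = 0 then x else y"]
    by (simp add: numeral_2_eq_2 Dexp_def toep_elem_def ip.rep_eq coord_lift_op b[OF D(1)] b[OF D(2)] b[OF D(3)] add_ac)
  obtain C where C: "\<And>f. f \<in> l2 \<Longrightarrow> l2norm (\<Phi> 0 f) \<le> C * l2norm f"
    using b[OF D(1)] unfolding bounded_op_def by blast
  have "Re (ip (lift_op (\<Phi> 0) x) x) \<le> C * Re (ip x x)" for x
  proof -
    have "Re (ip (lift_op (\<Phi> 0) x) x) \<le> cmod (ip (lift_op (\<Phi> 0) x) x)" by (rule complex_Re_le_cmod)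
    also have "\<dots> \<le> nrm (lift_op (\<Phi> 0) x) * nrm x" by (rule ip_Cauchy_Schwarz)
    also have "\<dots> \<le> (C * nrm x) * nrm x"
      using C[OF coord[of x]] unfolding coord_lift_op[OF b[OF D(1)], symmetric] l2norm_coord
      by (intro mult_right_mono) auto
    also have "\<dots> = C * Re (ip x x)" by (simp add: ip_eq_nrm power2_eq_square)
    finally show ?thesis .
  qed
  then show ?thesis using lin Q' by (auto simp: toep_map_def)
qed

lemma min_pos_imp_comm_pos:
  assumes X: "min_pos n X"
  shows "comm_pos TYPE('i) n X"
  unfolding comm_pos_def
proof (intro allI impI)
  fix \<Phi> \<Psi> :: "int \<Rightarrow> ('i \<Rightarrow> complex) \<Rightarrow> ('i \<Rightarrow> complex)"
  assume p: "cp_S1 \<Phi>" and q: "cp_S1 \<Psi>" and c: "commuting_ranges \<Phi> \<Psi>"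
  have b: "bounded_op (\<Phi> a)" "bounded_op (\<Psi> a)" if "a \<in> Dexp" for a
    using p q that by (auto simp: cp_S1_def)
  have co: "coord (lift_op (\<Phi> a) (lift_op (\<Psi> b) x)) = \<Phi> a (\<Psi> b (coord x))"
    "coord (lift_op (\<Psi> b) (lift_op (\<Phi> a) x)) = \<Psi> b (\<Phi> a (coord x))" if "a \<in> Dexp" "b \<in> Dexp" for a b x
    using b that by (auto simp: coord_lift_op)
  show "op_psd n (\<lambda>r s f t. \<Sum>a\<in>Dexp. \<Sum>b\<in>Dexp. X a b r s * \<Phi> a (\<Psi> b f) t)"
    unfolding op_psd_def
  proof (intro allI impI)
    fix h :: "nat \<Rightarrow> 'i \<Rightarrow> complex"
    assume h: "\<forall>j<n. h j \<in> l2"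
    define k where "k j = Abs_ell2 (h j)" for j
    have k: "coord (k j) = h j" if "j < n" for j using h that by (simp add: k_def Abs_ell2_inverse)
    have "0 \<le> (\<Sum>r<n. \<Sum>s<n. \<Sum>a\<in>Dexp. \<Sum>b\<in>Dexp. X a b r s * ip (lift_op (\<Phi> a) (lift_op (\<Psi> b) (k s))) (k r))"
    proof (intro commuting_toep_maps_nonneg cp_S1_toep_map p q X)
      fix a b x assume "a \<in> Dexp" "b \<in> Dexp"
      then show "lift_op (\<Phi> a) (lift_op (\<Psi> b) x) = lift_op (\<Psi> b) (lift_op (\<Phi> a) x)"
        using c coord[of x] by (simp add: co commuting_ranges_def flip: coord_inject)
    qed
    also have "\<dots> = (\<Sum>r<n. \<Sum>s<n. l2inner (\<lambda>t. \<Sum>a\<in>Dexp. \<Sum>b\<in>Dexp. X a b r s * \<Phi> a (\<Psi> b (h s)) t) (h r))"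
    proof (intro sum.cong refl)
      fix r s assume rs: "r \<in> {..<n}" "s \<in> {..<n}"
      let ?y = "\<Sum>a\<in>Dexp. \<Sum>b\<in>Dexp. scl (X a b r s) (lift_op (\<Phi> a) (lift_op (\<Psi> b) (k s)))"
      have cs: "coord (\<Sum>i\<in>I. f i) = (\<lambda>t. \<Sum>i\<in>I. coord (f i) t)" for I :: "int set" and f :: "int \<Rightarrow> 'i ell2"
        by (induction I rule: infinite_finite_induct) (auto simp: zero_ell2.rep_eq plus_ell2.rep_eq)
      have "coord ?y = (\<lambda>t. \<Sum>a\<in>Dexp. \<Sum>b\<in>Dexp. X a b r s * \<Phi> a (\<Psi> b (h s)) t)"
        using rs by (simp add: cs scl.rep_eq co k fun_eq_iff)
      then have "l2inner (\<lambda>t. \<Sum>a\<in>Dexp. \<Sum>b\<in>Dexp. X a b r s * \<Phi> a (\<Psi> b (h s)) t) (h r) = ip ?y (k r)"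
        using rs by (simp add: ip.rep_eq k)
      then show "(\<Sum>a\<in>Dexp. \<Sum>b\<in>Dexp. X a b r s * ip (lift_op (\<Phi> a) (lift_op (\<Psi> b) (k s))) (k r))
        = l2inner (\<lambda>t. \<Sum>a\<in>Dexp. \<Sum>b\<in>Dexp. X a b r s * \<Phi> a (\<Psi> b (h s)) t) (h r)"
        by (simp add: ip_sum_left ip_scl_left)
    qed
    finally show "0 \<le> (\<Sum>r<n. \<Sum>s<n. l2inner (\<lambda>t. \<Sum>a\<in>Dexp. \<Sum>b\<in>Dexp. X a b r s * \<Phi> a (\<Psi> b (h s)) t) (h r))" .
  qed
qed

lemma cnj_eq_inverse:
  assumes "cmod z = 1"
  shows "inverse z = cnj z"
  using assms by (simp add: inverse_complex_def complex_eq_iff cmod_def)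

text \<open>Point evaluation at \<open>z\<close>, acting by multiples of the identity; these maps
  detect the minimal order.\<close>

lemma cp_S1_scalar:
  assumes z: "cmod z = 1"
  shows "cp_S1 (\<lambda>a (f :: 'i \<Rightarrow> complex) t. z powi a * f t)"
  unfolding cp_S1_def
proof (intro conjI ballI allI impI)
  fix a
  have n: "cmod (z powi a) = 1" using z by (simp add: norm_power_int)
  show "bounded_op (\<lambda>(f :: 'i \<Rightarrow> complex) t. z powi a * f t)"
    unfolding bounded_op_def
    using n by (auto simp: l2_scale distrib_left mult.left_commute l2norm_def norm_mult intro!: exI[of _ 1])
next
  fix k P assume P: "S1_pos k P"
  define F where "F i j = (\<Sum>a\<in>Dexp. P a i j * z powi a)" for i j
  have "psd k F" using P z unfolding S1_pos_def F_def by simp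
  then have Fp: "Fpos k F (1 :: 'i aop)" by (rule Fpos_one)
  show "op_psd k (\<lambda>i j (f :: 'i \<Rightarrow> complex) t. \<Sum>a\<in>Dexp. P a i j * (z powi a * f t))"
    unfolding op_psd_def
  proof (intro allI impI)
    fix h :: "nat \<Rightarrow> 'i \<Rightarrow> complex"
    assume h: "\<forall>j<k. h j \<in> l2"
    have "0 \<le> (\<Sum>r<k. \<Sum>s<k. F r s * ip (app 1 (Abs_ell2 (h s))) (Abs_ell2 (h r)))"
      using Fp unfolding Fpos_def by (rule spec)
    also have "\<dots> = (\<Sum>r<k. \<Sum>s<k. l2inner (\<lambda>t. \<Sum>a\<in>Dexp. P a r s * (z powi a * h s t)) (h r))"
    proof (intro sum.cong refl)
      fix r s assume "r \<in> {..<k}" "s \<in> {..<k}"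
      then have "ip (app 1 (Abs_ell2 (h s))) (Abs_ell2 (h r)) = l2inner (h s) (h r)"
        using h by (simp add: l2inner_coord)
      moreover have "(\<lambda>t. \<Sum>a\<in>Dexp. P a r s * (z powi a * h s t)) = (\<lambda>t. F r s * h s t)"
        by (simp add: F_def sum_distrib_right mult.assoc)
      ultimately show "F r s * ip (app 1 (Abs_ell2 (h s))) (Abs_ell2 (h r))
        = l2inner (\<lambda>t. \<Sum>a\<in>Dexp. P a r s * (z powi a * h s t)) (h r)"
        by (simp add: l2inner_def mult.assoc infsum_cmult_right')
    qed
    finally show "0 \<le> (\<Sum>r<k. \<Sum>s<k. l2inner (\<lambda>t. \<Sum>a\<in>Dexp. P a r s * (z powi a * h s t)) (h r))" .
  qed
qed

lemma comm_pos_imp_min_pos: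
  assumes "comm_pos TYPE('i) n X"
  shows "min_pos n X"
  unfolding min_pos_def psd_def
proof (intro allI impI)
  fix z w :: complex and v :: "nat \<Rightarrow> complex"
  assume z: "cmod z = 1" and w: "cmod w = 1"
  define F where "F r s = (\<Sum>a\<in>Dexp. \<Sum>b\<in>Dexp. X a b r s * z powi a * w powi b)" for r s
  \<comment> \<open>A nonzero vector exists since 0 and 1 differ in the operator ring. The scalar
    vector \<open>v\<close> is tested through its multiples \<open>scl (v s) e\<close>.\<close>
  obtain e :: "'i ell2" where e: "e \<noteq> 0"
    by (metis aop_eqI zero_aop.rep_eq one_aop.rep_eq zero_neq_one)
  then have pe: "nrm e > 0"
    using ip_definite[of e] ip_eq_nrm[of e] nrm_nonneg[of e] by (fastforce simp: less_le)
  define h where "h s = coord (scl (v s) e)" for s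
  have c: "commuting_ranges (\<lambda>a (f :: 'i \<Rightarrow> complex) t. z powi a * f t) (\<lambda>b f t. w powi b * f t)"
    by (simp add: commuting_ranges_def mult.left_commute)
  have op: "op_psd n (\<lambda>r s (f :: 'i \<Rightarrow> complex) t. \<Sum>a\<in>Dexp. \<Sum>b\<in>Dexp. X a b r s * (z powi a * (w powi b * f t)))"
    using assms cp_S1_scalar[OF z] cp_S1_scalar[OF w] c unfolding comm_pos_def by blast
  have "0 \<le> (\<Sum>r<n. \<Sum>s<n. l2inner (\<lambda>t. \<Sum>a\<in>Dexp. \<Sum>b\<in>Dexp. X a b r s * (z powi a * (w powi b * h s t))) (h r))"
    by (rule op[unfolded op_psd_def, rule_format]) (simp only: h_def coord)
  also have "\<dots> = (\<Sum>r<n. \<Sum>s<n. cnj (v r) * F r s * v s * of_real ((nrm e)\<^sup>2))"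
  proof (intro sum.cong refl)
    fix r s
    have "(\<lambda>t. \<Sum>a\<in>Dexp. \<Sum>b\<in>Dexp. X a b r s * (z powi a * (w powi b * h s t))) = coord (scl (F r s * v s) e)"
      by (simp add: F_def h_def scl.rep_eq sum_distrib_right mult.assoc)
    then show "l2inner (\<lambda>t. \<Sum>a\<in>Dexp. \<Sum>b\<in>Dexp. X a b r s * (z powi a * (w powi b * h s t))) (h r)
      = cnj (v r) * F r s * v s * of_real ((nrm e)\<^sup>2)"
      unfolding h_def by (simp add: ip_scl_left ip_scl_right ip_eq_nrm flip: ip.rep_eq)
  qed
  also have "\<dots> = (\<Sum>r<n. \<Sum>s<n. cnj (v r) * F r s * v s) * of_real ((nrm e)\<^sup>2)"
    by (simp add: sum_distrib_right)
  finally have "0 \<le> (\<Sum>r<n. \<Sum>s<n. cnj (v r) * F r s * v s) * of_real ((nrm e)\<^sup>2)" .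
  then show "0 \<le> (\<Sum>r<n. \<Sum>s<n. cnj (v r) * (\<Sum>a\<in>Dexp. \<Sum>b\<in>Dexp. X a b r s * z powi a * w powi b) * v s)"
    using pe unfolding F_def[symmetric]
    by (simp add: less_eq_complex_def zero_le_mult_iff flip: of_real_power)
qed

section \<open>Positivity of the identity map\<close>

lemma complex_half_nonneg: "0 \<le> x + y \<Longrightarrow> 0 \<le> x - y \<Longrightarrow> 0 \<le> (x::complex)"
  by (auto simp: less_eq_complex_def)

text \<open>The hypothesis is used at the phase of \<open>cnj p * q\<close>, and the excess of
  \<open>(cmod p)^2 + (cmod q)^2\<close> over \<open>2 * cmod u\<close> is a square.\<close>

lemma psd_2_of_unimodular:
  fixes x0 x1 xm :: complex
  assumes "\<And>w. cmod w = 1 \<Longrightarrow> 0 \<le> x0 + x1 * w + xm * cnj w"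
  shows "0 \<le> x0 / 2 * (p * cnj p + q * cnj q) + x1 * (cnj p * q) + xm * (cnj q * p)"
proof -
  have "0 \<le> x0 + (x1 + xm)" "0 \<le> x0 - (x1 + xm)"
    using assms[of 1] assms[of "-1"] by (auto simp: add.assoc diff_diff_eq)
  then have x0: "0 \<le> x0" by (rule complex_half_nonneg)
  define u where "u = cnj p * q"
  \<comment> \<open>For \<open>u = 0\<close> the phase is arbitrary; 1 keeps it unimodular.\<close>
  define w where "w = (if u = 0 then 1 else sgn u)"
  have w: "cmod w = 1" by (simp add: w_def norm_sgn)
  have uw: "of_real (cmod u) * w = u"
    by (auto simp: w_def sgn_div_norm scaleR_conv_of_real field_simps)
  have uw': "of_real (cmod u) * cnj w = cnj u"
    using arg_cong[OF uw, of cnj] by simp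
  have cu: "cmod u = cmod p * cmod q" by (simp add: u_def norm_mult)
  have "0 \<le> of_real (cmod u) * (x0 + x1 * w + xm * cnj w) + x0 / 2 * of_real ((cmod p - cmod q)\<^sup>2)"
    using x0 by (intro add_nonneg_nonneg mult_nonneg_nonneg assms w) (auto simp: less_eq_complex_def)
  also have "\<dots> = x0 / 2 * of_real ((cmod p - cmod q)\<^sup>2 + 2 * cmod u)
     + x1 * (of_real (cmod u) * w) + xm * (of_real (cmod u) * cnj w)"
    by (simp add: algebra_simps)
  also have "\<dots> = x0 / 2 * of_real ((cmod p)\<^sup>2 + (cmod q)\<^sup>2) + x1 * u + xm * cnj u"
    unfolding uw uw' by (simp add: cu power2_diff)
  also have "\<dots> = x0 / 2 * (p * cnj p + q * cnj q) + x1 * (cnj p * q) + xm * (cnj q * p)"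
    unfolding u_def of_real_add complex_norm_square by (simp add: mult.commute)
  finally show ?thesis .
qed

lemma min_pos_1_imp_max_D:
  assumes X: "min_pos 1 X"
  shows "max_D 1 X"
proof -
  define P :: "int \<Rightarrow> cmat" where "P a i j = (if i = j then X a 0 0 0 / 2
      else if i = 0 then X a 1 0 0 else X a (-1) 0 0)" for a i j
  \<comment> \<open>Rows 0 and 3 are the index pairs (0,0) and (1,1), so compressing by
    \<open>A\<close> adds up the entrywise products of \<open>P\<close> and
    \<open>toep_elem\<close>.\<close>
  define A :: cmat where "A l r = (if l = 0 \<or> l = 3 then 1 else 0)" for l r
  have "S1_pos 2 P"
    unfolding S1_pos_def psd_def
  proof (intro allI impI)
    fix z :: complex and v :: "nat \<Rightarrow> complex" assume z: "cmod z = 1"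
    define x where "x b = (\<Sum>a\<in>Dexp. X a b 0 0 * z powi a)" for b
    have "0 \<le> x 0 + x 1 * w + x (-1) * cnj w" if w: "cmod w = 1" for w
    proof -
      have "psd 1 (\<lambda>r s. \<Sum>a\<in>Dexp. \<Sum>b\<in>Dexp. X a b r s * z powi a * w powi b)"
        using X z w by (auto simp: min_pos_def)
      then have "0 \<le> (\<Sum>a\<in>Dexp. \<Sum>b\<in>Dexp. X a b 0 0 * z powi a * w powi b)"
        unfolding psd_def by (auto dest!: spec[where x = "\<lambda>_. 1"])
      also have "\<dots> = x 0 + x 1 * w + x (-1) * cnj w"
        by (simp add: x_def Dexp_def cnj_eq_inverse[OF w] algebra_simps)
      finally show ?thesis .
    qed
    from psd_2_of_unimodular[OF this, of "v 0" "v 1"]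
    show "0 \<le> (\<Sum>i<2. \<Sum>j<2. cnj (v i) * (\<Sum>a\<in>Dexp. P a i j * z powi a) * v j)"
      by (simp add: numeral_2_eq_2 P_def x_def Dexp_def add_divide_distrib algebra_simps)
  qed
  moreover have "X a b r s = (\<Sum>i<2. \<Sum>j<2. \<Sum>p<2. \<Sum>q<2.
       cnj (A (i*2+p) r) * (P a i j * toep_elem b p q) * A (j*2+q) s)"
    if "b \<in> Dexp" "r < 1" "s < 1" for a b r s
    using that by (auto simp: numeral_2_eq_2 A_def P_def toep_elem_def Dexp_def)
  ultimately show ?thesis
    unfolding max_D_def using S1_pos_toep_elem by blast
qed

text \<open>Minimal positivity survives adding a positive multiple of the unit, and at level 1 it
  gives membership in \<open>max_D\<close> outright.\<close>

lemma min_pos_1_imp_max_pos: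
  assumes X: "min_pos 1 X"
  shows "max_pos 1 X"
  unfolding max_pos_def
proof (intro allI impI)
  fix e :: real assume e: "e > 0"
  let ?Y = "\<lambda>a b r s. X a b r s + (if a = 0 \<and> b = 0 \<and> r = s then complex_of_real e else 0)"
  have "min_pos 1 ?Y"
    unfolding min_pos_def psd_def
  proof (intro allI impI)
    fix z w :: complex and v :: "nat \<Rightarrow> complex" assume zw: "cmod z = 1" "cmod w = 1"
    have "psd 1 (\<lambda>r s. \<Sum>a\<in>Dexp. \<Sum>b\<in>Dexp. X a b r s * z powi a * w powi b)"
      using X zw by (auto simp: min_pos_def)
    then have "0 \<le> (\<Sum>i<1. \<Sum>j<1. cnj (v i) * (\<Sum>a\<in>Dexp. \<Sum>b\<in>Dexp. X a b i j * z powi a * w powi b) * v j)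
       + of_real e * (v 0 * cnj (v 0))"
      unfolding psd_def using e
      by (intro add_nonneg_nonneg mult_nonneg_nonneg mult_cnj_nonneg) (auto simp: less_eq_complex_def)
    also have "\<dots> = (\<Sum>i<1. \<Sum>j<1. cnj (v i) * (\<Sum>a\<in>Dexp. \<Sum>b\<in>Dexp. ?Y a b i j * z powi a * w powi b) * v j)"
      by (simp add: Dexp_def algebra_simps)
    finally show "0 \<le> (\<Sum>i<1. \<Sum>j<1. cnj (v i) * (\<Sum>a\<in>Dexp. \<Sum>b\<in>Dexp. ?Y a b i j * z powi a * w powi b) * v j)" .
  qed
  then show "max_D 1 ?Y" by (rule min_pos_1_imp_max_D)
qed

section \<open>The Shifts unextendible product basis\<close>

lemma l2_finite_support:
  assumes "finite I"
  shows "(\<lambda>i. if i \<in> I then f i else 0) \<in> l2"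
proof -
  have "(\<lambda>i. (cmod (if i \<in> I then f i else 0))\<^sup>2) summable_on I"
    using assms by simp
  then have "(\<lambda>i. (cmod (if i \<in> I then f i else 0))\<^sup>2) summable_on UNIV"
    by (rule summable_on_cong_neutral[THEN iffD1, rotated -1]) auto
  then show ?thesis by (simp add: l2_def)
qed

lemma l2inner_finite_support:
  assumes "finite I"
  shows "l2inner (\<lambda>i. if i \<in> I then f i else 0) g = (\<Sum>i\<in>I. f i * cnj (g i))"
proof -
  have "l2inner (\<lambda>i. if i \<in> I then f i else 0) g = (\<Sum>\<^sub>\<infinity>i\<in>I. f i * cnj (g i))"
    unfolding l2inner_def by (rule infsum_cong_neutral) auto
  then show ?thesis using assms by simp
qed

text \<open>A finite matrix acts on the coordinates in \<open>I\<close> and kills the others, so the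
  operator results above cover matrix-valued maps.\<close>

definition matrix_op :: "'i set \<Rightarrow> ('i \<Rightarrow> 'i \<Rightarrow> complex) \<Rightarrow> 'i ell2 \<Rightarrow> 'i ell2" where
  "matrix_op I M x = Abs_ell2 (\<lambda>i. if i \<in> I then \<Sum>j\<in>I. M i j * coord x j else 0)"

lemma ip_matrix_op:
  assumes "finite I"
  shows "ip (matrix_op I M x) y = (\<Sum>i\<in>I. \<Sum>j\<in>I. M i j * coord x j * cnj (coord y i))"
  unfolding matrix_op_def ip.rep_eq Abs_ell2_inverse[OF l2_finite_support[OF assms]]
  by (simp add: l2inner_finite_support[OF assms] sum_distrib_right)

lemma toep_map_matrix_op:
  assumes I: "finite I"
    and Q: "\<And>x y :: 'i \<Rightarrow> complex. 0 \<le> (\<Sum>i\<in>I. \<Sum>j\<in>I.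
      M 0 i j * x j * cnj (x i) + M 0 i j * y j * cnj (y i)
      + M 1 i j * y j * cnj (x i) + M (-1) i j * x j * cnj (y i))"
  shows "toep_map (\<lambda>a. matrix_op I (M a))"
  unfolding toep_map_def
proof (intro conjI ballI allI)
  fix a x y c
  show "matrix_op I (M a) (x + y) = matrix_op I (M a) x + matrix_op I (M a) y"
    by (rule ip_ext)
       (simp add: ip_add_left ip_matrix_op[OF I] plus_ell2.rep_eq algebra_simps sum.distrib)
  show "matrix_op I (M a) (scl c x) = scl c (matrix_op I (M a) x)"
    by (rule ip_ext) (simp add: ip_scl_left ip_matrix_op[OF I] scl.rep_eq sum_distrib_left mult_ac)
  show "0 \<le> ip (matrix_op I (M 0) x) x + ip (matrix_op I (M 0) y) y + ip (matrix_op I (M 1) y) x + ip (matrix_op I (M (- 1)) x) y"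
    using Q[of "coord x" "coord y"] by (simp add: ip_matrix_op[OF I] sum.distrib)
next
  have "Re (ip (matrix_op I (M 0) x) x) \<le> (\<Sum>i\<in>I. \<Sum>j\<in>I. cmod (M 0 i j)) * Re (ip x x)" for x
  proof -
    have le: "cmod (coord x i) \<le> nrm x" for i
    proof -
      have "(cmod (coord x i))\<^sup>2 = (\<Sum>\<^sub>\<infinity>i\<in>{i}. (cmod (coord x i))\<^sup>2)" by simp
      also have "\<dots> \<le> (\<Sum>\<^sub>\<infinity>i. (cmod (coord x i))\<^sup>2)"
        using coord[of x] by (intro infsum_mono2) (auto simp: l2_def)
      also have "\<dots> = (nrm x)\<^sup>2"
        using ip_eq_infsum_cmod[of x] ip_eq_nrm[of x] by (metis of_real_eq_iff)
      finally show ?thesis by (rule power2_le_imp_le) simp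
    qed
    have "Re (ip (matrix_op I (M 0) x) x) \<le> cmod (ip (matrix_op I (M 0) x) x)" by (rule complex_Re_le_cmod)
    also have "\<dots> \<le> (\<Sum>i\<in>I. \<Sum>j\<in>I. cmod (M 0 i j) * (nrm x * nrm x))"
      unfolding ip_matrix_op[OF I]
      by (intro sum_norm_le) (auto simp: norm_mult mult.assoc le intro!: mult_left_mono mult_mono)
    also have "\<dots> = (\<Sum>i\<in>I. \<Sum>j\<in>I. cmod (M 0 i j)) * Re (ip x x)"
      by (simp add: ip_eq_nrm sum_distrib_right power2_eq_square)
    finally show ?thesis .
  qed
  then show "\<exists>C. \<forall>x. Re (ip (matrix_op I (M 0) x) x) \<le> C * Re (ip x x)" by blast
qed

text \<open>The matrix case of \<open>toep_map_nonneg\<close>: pairing with a positive block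
  Toeplitz matrix preserves positivity.\<close>

lemma toeplitz_matrix_nonneg:
  fixes M :: "int \<Rightarrow> 'i \<Rightarrow> 'i \<Rightarrow> complex"
  assumes I: "finite I"
    and Q: "\<And>x y :: 'i \<Rightarrow> complex. 0 \<le> (\<Sum>i\<in>I. \<Sum>j\<in>I.
      M 0 i j * x j * cnj (x i) + M 0 i j * y j * cnj (y i)
      + M 1 i j * y j * cnj (x i) + M (-1) i j * x j * cnj (y i))"
    and P: "S1_pos k P"
  shows "0 \<le> (\<Sum>i<k. \<Sum>j<k. \<Sum>a\<in>Dexp. P a i j * (\<Sum>u\<in>I. \<Sum>v\<in>I. M a u v * h j v * cnj (h i u)))"
proof -
  define g where "g i = Abs_ell2 (\<lambda>u. if u \<in> I then h i u else 0)" for i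
  have g: "coord (g i) u = h i u" if "u \<in> I" for i u
    unfolding g_def using that by (simp add: Abs_ell2_inverse l2_finite_support[OF I])
  have "0 \<le> (\<Sum>i<k. \<Sum>j<k. \<Sum>a\<in>Dexp. P a i j * ip (matrix_op I (M a) (g j)) (g i))"
    by (rule toep_map_nonneg[OF toep_map_matrix_op[OF I Q] P])
  then show ?thesis by (simp add: ip_matrix_op[OF I] g)
qed

text \<open>Bessel's inequality for the conjugates of the vectors \<open>\<phi> k\<close>, with
  \<open>y\<close> the projection of \<open>x\<close> onto their span.\<close>

lemma bessel_nonneg:
  fixes \<phi> :: "'k \<Rightarrow> 'i \<Rightarrow> complex" and n :: "'k \<Rightarrow> real"
  assumes "finite I" "finite K" and n: "\<And>k. k \<in> K \<Longrightarrow> n k \<noteq> 0"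
    and orth: "\<And>k l. k \<in> K \<Longrightarrow> l \<in> K \<Longrightarrow>
      (\<Sum>i\<in>I. \<phi> k i * cnj (\<phi> l i)) = (if k = l then of_real (n k) else 0)"
  defines "d \<equiv> \<lambda>x k. \<Sum>i\<in>I. \<phi> k i * x i"
  shows "0 \<le> (\<Sum>i\<in>I. x i * cnj (x i)) - (\<Sum>k\<in>K. d x k * cnj (d x k) / of_real (n k))"
proof -
  define e where "e k = d x k / of_real (n k)" for k
  define S where "S = (\<Sum>k\<in>K. d x k * cnj (d x k) / of_real (n k))"
  define y where "y i = (\<Sum>k\<in>K. e k * cnj (\<phi> k i))" for i
  have xy: "(\<Sum>i\<in>I. x i * cnj (y i)) = S"
  proof -
    have "(\<Sum>i\<in>I. x i * cnj (y i)) = (\<Sum>i\<in>I. \<Sum>k\<in>K. cnj (e k) * (\<phi> k i * x i))"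
      by (simp add: y_def sum_distrib_left mult_ac)
    also have "\<dots> = (\<Sum>k\<in>K. cnj (e k) * d x k)"
      by (subst sum.swap) (simp add: d_def sum_distrib_left)
    also have "\<dots> = S" by (simp add: S_def e_def mult_ac)
    finally show ?thesis .
  qed
  have "cnj S = S" by (simp add: S_def mult_ac)
  then have yx: "(\<Sum>i\<in>I. y i * cnj (x i)) = S"
    using arg_cong[OF xy, of cnj] by (simp add: mult_ac)
  have "(\<Sum>i\<in>I. y i * cnj (y i)) = (\<Sum>i\<in>I. \<Sum>k\<in>K. e k * (cnj (\<phi> k i) * cnj (y i)))"
    by (subst (1) y_def) (simp add: sum_distrib_right mult.assoc)
  also have "\<dots> = (\<Sum>k\<in>K. e k * cnj (\<Sum>i\<in>I. \<phi> k i * y i))"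
    by (subst sum.swap) (simp add: sum_distrib_left)
  also have "\<dots> = (\<Sum>k\<in>K. e k * cnj (d x k))"
  proof (intro sum.cong refl)
    fix k assume k: "k \<in> K"
    have "(\<Sum>i\<in>I. \<phi> k i * y i) = (\<Sum>i\<in>I. \<Sum>l\<in>K. e l * (\<phi> k i * cnj (\<phi> l i)))"
      by (simp add: y_def sum_distrib_left mult_ac)
    also have "\<dots> = (\<Sum>l\<in>K. e l * (\<Sum>i\<in>I. \<phi> k i * cnj (\<phi> l i)))"
      by (subst sum.swap) (simp add: sum_distrib_left)
    also have "\<dots> = (\<Sum>l\<in>K. if k = l then e l * of_real (n k) else 0)"
      using k by (intro sum.cong refl) (simp add: orth)
    also have "\<dots> = d x k" using k n \<open>finite K\<close> by (simp add: e_def)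
    finally show "e k * cnj (\<Sum>i\<in>I. \<phi> k i * y i) = e k * cnj (d x k)" by simp
  qed
  also have "\<dots> = S" by (simp add: S_def e_def mult_ac)
  finally have yy: "(\<Sum>i\<in>I. y i * cnj (y i)) = S" .
  have "0 \<le> (\<Sum>i\<in>I. (x i - y i) * cnj (x i - y i))"
    by (intro sum_nonneg) (rule mult_cnj_nonneg)
  also have "\<dots> = (\<Sum>i\<in>I. x i * cnj (x i)) - (\<Sum>i\<in>I. x i * cnj (y i)) - (\<Sum>i\<in>I. y i * cnj (x i))
     + (\<Sum>i\<in>I. y i * cnj (y i))"
    by (simp add: algebra_simps sum.distrib sum_subtractf)
  finally show ?thesis unfolding xy yx yy S_def by simp
qed

text \<open>
  The point \<open>e\<^sup>2\<^sup>i\<^sup>\<theta>\<close> of the circle stands for the qubit \<open>(cos \<theta>, sin \<theta>)\<close>, so \<open>1, -1, \<i>, -\<i>\<close> stand for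
  \<open>|0>, |1>, |+>, |->\<close>, and \<open>zk, wk, ck\<close> list the factors of \<open>|01+>, |1+0>, |+01>, |--->\<close>.
  The vectors \<open>ck\<close> are left unnormalised to avoid square roots; \<open>nk\<close> compensates for this.\<close>

definition zk :: "nat \<Rightarrow> complex" where
  "zk k = (if k = 0 then 1 else if k = 1 then -1 else if k = 2 then \<i> else -\<i>)"

definition wk :: "nat \<Rightarrow> complex" where
  "wk k = (if k = 0 then -1 else if k = 1 then \<i> else if k = 2 then 1 else -\<i>)"

definition ck :: "nat \<Rightarrow> nat \<Rightarrow> complex" where
  "ck k r = (if k = 0 then 1 else if k = 1 then (if r = 0 then 1 else 0)
     else if k = 2 then (if r = 0 then 0 else 1) else (if r = 0 then 1 else -1))"

definition nk :: "nat \<Rightarrow> real" where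
  "nk k = (if k = 0 \<or> k = 3 then 8 else 4)"

text \<open>For unimodular \<open>z\<close> with angle \<open>2 * theta\<close>, the vector
  \<open>(1, z)\<close> is the qubit \<open>(cos theta, sin theta)\<close> up to phase, scaling and
  a fixed unitary. In this basis the entries of its projection depend only on index
  differences.\<close>

definition upb :: "nat \<Rightarrow> nat \<times> nat \<times> nat \<Rightarrow> complex" where
  "upb k = (\<lambda>(i, p, r). zk k ^ i * wk k ^ p * ck k r)"

text \<open>Matrix entries of \<open>4 (1 - projection onto the product basis)\<close>, written as a doubly Toeplitz kernel.\<close>

definition tcoef :: "int \<Rightarrow> int \<Rightarrow> cmat" where
  "tcoef a b r s = 4 * ((if a = 0 \<and> b = 0 \<and> r = s then 1 else 0)
      - (\<Sum>k<4. zk k powi a * wk k powi b * ck k r * ck k s / of_real (nk k)))"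

lemma zk_powi: "zk k powi (int j - int i) = zk k ^ j * cnj (zk k ^ i)"
proof -
  have "inverse (zk k) = cnj (zk k)" "zk k \<noteq> 0" by (auto simp: zk_def)
  then show ?thesis by (simp add: power_int_diff divide_inverse flip: power_inverse)
qed

lemma wk_powi: "wk k powi (int j - int i) = wk k ^ j * cnj (wk k ^ i)"
proof -
  have "inverse (wk k) = cnj (wk k)" "wk k \<noteq> 0" by (auto simp: wk_def)
  then show ?thesis by (simp add: power_int_diff divide_inverse flip: power_inverse)
qed

lemma tcoef_kernel:
  "tcoef (int j - int i) (int q - int p) r s = 4 * ((if (i, p, r) = (j, q, s) then 1 else 0)
      - (\<Sum>k<4. upb k (j, q, s) * cnj (upb k (i, p, r)) / of_real (nk k)))"
proof -
  have "cnj (ck k r) = ck k r" for k by (simp add: ck_def)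
  then show ?thesis
    by (simp add: tcoef_def zk_powi wk_powi upb_def mult_ac eq_commute[of i] eq_commute[of p])
qed

abbreviation cube :: "(nat \<times> nat \<times> nat) set" where
  "cube \<equiv> {..<2} \<times> {..<2} \<times> {..<2}"

lemma sum_cube: "(\<Sum>u\<in>cube. f u) = (\<Sum>i<2. \<Sum>p<2. \<Sum>r<2. f (i, p, r))"
  unfolding sum.cartesian_product by (simp add: case_prod_unfold)

text \<open>Any two of the product vectors are orthogonal in one of the three factors.\<close>

lemma upb_orth:
  assumes "k < 4" "l < 4"
  shows "(\<Sum>i\<in>cube. upb k i * cnj (upb l i)) = (if k = l then of_real (nk k) else 0)"
proof -
  have "k \<in> {0, 1, 2, 3}" "l \<in> {0, 1, 2, 3}" using assms by auto
  then show ?thesis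
    unfolding sum_cube by (auto simp: upb_def zk_def wk_def ck_def nk_def numeral_2_eq_2)
qed

text \<open>Four times Bessel's inequality for the product basis.\<close>

lemma tcoef_form_nonneg:
  fixes x :: "nat \<times> nat \<times> nat \<Rightarrow> complex"
  shows "0 \<le> (\<Sum>(i, p, r)\<in>cube. \<Sum>(j, q, s)\<in>cube.
    tcoef (int j - int i) (int q - int p) r s * x (j, q, s) * cnj (x (i, p, r)))"
proof -
  define d where "d k = (\<Sum>i\<in>cube. upb k i * x i)" for k
  have fin: "finite cube" by simp
  have "0 \<le> (\<Sum>u\<in>cube. x u * cnj (x u)) - (\<Sum>k<4. d k * cnj (d k) / of_real (nk k))"
    unfolding d_def
  proof (rule bessel_nonneg)
    show "nk k \<noteq> 0" for k by (simp add: nk_def)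
  qed (auto simp: upb_orth)
  moreover have "0 \<le> (4::complex)" by (simp add: less_eq_complex_def)
  ultimately have "0 \<le> 4 * ((\<Sum>u\<in>cube. x u * cnj (x u)) - (\<Sum>k<4. d k * cnj (d k) / of_real (nk k)))"
    by (rule mult_nonneg_nonneg[rotated])
  also have "\<dots> = (\<Sum>u\<in>cube. \<Sum>v\<in>cube. 4 * ((if u = v then 1 else 0)
      - (\<Sum>k<4. upb k v * cnj (upb k u) / of_real (nk k))) * x v * cnj (x u))"
  proof -
    have 1: "(\<Sum>u\<in>cube. \<Sum>v\<in>cube. (if u = v then 1 else 0) * x v * cnj (x u)) = (\<Sum>u\<in>cube. x u * cnj (x u))"
    proof (intro sum.cong refl)
      fix u assume "u \<in> cube"
      have "(\<Sum>v\<in>cube. (if u = v then 1 else 0) * x v * cnj (x u)) = (\<Sum>v\<in>cube. if u = v then x v * cnj (x u) else 0)"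
        by (intro sum.cong refl) auto
      also have "\<dots> = x u * cnj (x u)" using \<open>u \<in> cube\<close> by (subst sum.delta'[OF fin]) auto
      finally show "(\<Sum>v\<in>cube. (if u = v then 1 else 0) * x v * cnj (x u)) = x u * cnj (x u)" .
    qed
    define \<kappa> where "\<kappa> u v = (\<Sum>k<4. upb k v * cnj (upb k u) / of_real (nk k))" for u v
    have 2: "(\<Sum>u\<in>cube. \<Sum>v\<in>cube. \<kappa> u v * x v * cnj (x u))
      = (\<Sum>k<4. d k * cnj (d k) / of_real (nk k))"
    proof -
      have "(\<Sum>u\<in>cube. \<Sum>v\<in>cube. (\<Sum>k<4. upb k v * cnj (upb k u) / of_real (nk k)) * x v * cnj (x u))
        = (\<Sum>u\<in>cube. \<Sum>v\<in>cube. \<Sum>k<4. (upb k v * x v) * (cnj (upb k u) * cnj (x u)) / of_real (nk k))"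
        unfolding sum_distrib_right by (intro sum.cong refl) (simp add: mult_ac)
      also have "\<dots> = (\<Sum>u\<in>cube. \<Sum>k<4. \<Sum>v\<in>cube. (upb k v * x v) * (cnj (upb k u) * cnj (x u)) / of_real (nk k))"
        by (intro sum.cong refl sum.swap)
      also have "\<dots> = (\<Sum>k<4. \<Sum>u\<in>cube. \<Sum>v\<in>cube. (upb k v * x v) * (cnj (upb k u) * cnj (x u)) / of_real (nk k))"
        by (rule sum.swap)
      also have "\<dots> = (\<Sum>k<4. d k * cnj (d k) / of_real (nk k))"
      proof (intro sum.cong refl)
        fix k
        have "(\<Sum>u\<in>cube. \<Sum>v\<in>cube. (upb k v * x v) * (cnj (upb k u) * cnj (x u)) / of_real (nk k))
          = (\<Sum>u\<in>cube. d k * (cnj (upb k u) * cnj (x u)) / of_real (nk k))"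
          unfolding d_def sum_distrib_right sum_divide_distrib ..
        also have "\<dots> = d k * (\<Sum>u\<in>cube. cnj (upb k u) * cnj (x u)) / of_real (nk k)"
          unfolding sum_distrib_left sum_divide_distrib ..
        also have "(\<Sum>u\<in>cube. cnj (upb k u) * cnj (x u)) = cnj (d k)"
          unfolding d_def cnj_sum complex_cnj_mult ..
        finally show "(\<Sum>u\<in>cube. \<Sum>v\<in>cube. (upb k v * x v) * (cnj (upb k u) * cnj (x u)) / of_real (nk k))
          = d k * cnj (d k) / of_real (nk k)" .
      qed
      finally show ?thesis unfolding \<kappa>_def .
    qed
    show ?thesis
      unfolding 1[symmetric] 2[symmetric] \<kappa>_def[symmetric]
      unfolding right_diff_distrib left_diff_distrib sum_subtractf sum_distrib_left mult.assoc ..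
  qed
  also have "\<dots> = (\<Sum>(i, p, r)\<in>cube. \<Sum>(j, q, s)\<in>cube.
    tcoef (int j - int i) (int q - int p) r s * x (j, q, s) * cnj (x (i, p, r)))"
    by (intro sum.cong refl) (auto simp: tcoef_kernel intro!: sum.cong)
  finally show ?thesis .
qed

abbreviation square :: "(nat \<times> nat) set" where
  "square \<equiv> {..<2} \<times> {..<2}"

lemma sum_Times: "(\<Sum>u\<in>S \<times> T. f u) = (\<Sum>i\<in>S. \<Sum>r\<in>T. f (i, r))"
  unfolding sum.cartesian_product by simp

text \<open>The kernel is Toeplitz in its first qubit, so that qubit can be paired with a positive
  \<open>P\<close>; the vectors \<open>x\<close> and \<open>y\<close> are its two layers.\<close>

lemma tcoef_nonneg_S1_pos:
  assumes P: "S1_pos k P"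
  shows "0 \<le> (\<Sum>i<k. \<Sum>j<k. \<Sum>a\<in>Dexp. P a i j * (\<Sum>u\<in>square. \<Sum>v\<in>square.
     tcoef a (int (fst v) - int (fst u)) (snd u) (snd v) * h j v * cnj (h i u)))"
proof (rule toeplitz_matrix_nonneg[OF _ _ P])
  fix x y :: "nat \<times> nat \<Rightarrow> complex"
  let ?t = "\<lambda>a u v. tcoef a (int (fst v) - int (fst u)) (snd u) (snd v)"
  define X where "X = (\<lambda>(i::nat, u). if i = 0 then x u else y u)"
  have "(\<Sum>(i, p, r)\<in>cube. \<Sum>(j, q, s)\<in>cube.
      tcoef (int j - int i) (int q - int p) r s * X (j, q, s) * cnj (X (i, p, r)))
    = (\<Sum>i<2. \<Sum>u\<in>square. \<Sum>j<2. \<Sum>v\<in>square. ?t (int j - int i) u v * X (j, v) * cnj (X (i, u)))"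
    by (simp only: sum_Times prod.case fst_conv snd_conv)
  also have "\<dots> = (\<Sum>i<2. \<Sum>j<2. \<Sum>u\<in>square. \<Sum>v\<in>square. ?t (int j - int i) u v * X (j, v) * cnj (X (i, u)))"
    by (intro sum.cong refl sum.swap)
  also have "\<dots> = (\<Sum>u\<in>square. \<Sum>v\<in>square. ?t 0 u v * x v * cnj (x u) + ?t 0 u v * y v * cnj (y u)
      + ?t 1 u v * y v * cnj (x u) + ?t (-1) u v * x v * cnj (y u))"
    by (simp add: numeral_2_eq_2 X_def sum.distrib)
  finally show "0 \<le> (\<Sum>u\<in>square. \<Sum>v\<in>square. ?t 0 u v * x v * cnj (x u) + ?t 0 u v * y v * cnj (y u)
      + ?t 1 u v * y v * cnj (x u) + ?t (-1) u v * x v * cnj (y u))"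
    using tcoef_form_nonneg[of X] by simp
qed simp

text \<open>Once paired with \<open>P\<close>, the kernel is still Toeplitz in the second qubit, and
  the previous lemma supplies the positivity needed to pair again.\<close>

lemma tcoef_nonneg_S1_pos_S1_pos:
  assumes P: "S1_pos k P" and Q: "S1_pos m Q"
  shows "0 \<le> (\<Sum>p<m. \<Sum>q<m. \<Sum>b\<in>Dexp. Q b p q * (\<Sum>u\<in>{..<k}\<times>{..<2}. \<Sum>v\<in>{..<k}\<times>{..<2}.
     (\<Sum>a\<in>Dexp. P a (fst u) (fst v) * tcoef a b (snd u) (snd v)) * h q v * cnj (h p u)))"
proof (rule toeplitz_matrix_nonneg[OF _ _ Q])
  fix x y :: "nat \<times> nat \<Rightarrow> complex"
  let ?I = "{..<k}\<times>{..<2::nat}"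
  let ?M = "\<lambda>b u v. \<Sum>a\<in>Dexp. P a (fst u) (fst v) * tcoef a b (snd u) (snd v)"
  \<comment> \<open>The first coordinate of \<open>u\<close> now selects the layer \<open>x\<close>
    or \<open>y\<close>, while the index \<open>i\<close> of \<open>P\<close> moves outside.\<close>
  define g where "g i u = (if fst u = 0 then x (i, snd u) else y (i, snd u))" for i and u :: "nat \<times> nat"
  have "(\<Sum>u\<in>?I. \<Sum>v\<in>?I. ?M 0 u v * x v * cnj (x u) + ?M 0 u v * y v * cnj (y u)
      + ?M 1 u v * y v * cnj (x u) + ?M (-1) u v * x v * cnj (y u))
    = (\<Sum>i<k. \<Sum>r<2. \<Sum>j<k. \<Sum>s<2. 
        ?M 0 (i,r) (j,s) * x (j,s) * cnj (x (i,r)) + ?M 0 (i,r) (j,s) * y (j,s) * cnj (y (i,r))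
      + ?M 1 (i,r) (j,s) * y (j,s) * cnj (x (i,r)) + ?M (-1) (i,r) (j,s) * x (j,s) * cnj (y (i,r)))"
    by (simp only: sum_Times prod.case fst_conv snd_conv)
  also have "\<dots> = (\<Sum>i<k. \<Sum>j<k. \<Sum>r<2. \<Sum>s<2. 
        ?M 0 (i,r) (j,s) * x (j,s) * cnj (x (i,r)) + ?M 0 (i,r) (j,s) * y (j,s) * cnj (y (i,r))
      + ?M 1 (i,r) (j,s) * y (j,s) * cnj (x (i,r)) + ?M (-1) (i,r) (j,s) * x (j,s) * cnj (y (i,r)))"
    by (intro sum.cong refl sum.swap)
  also have "\<dots> = (\<Sum>i<k. \<Sum>j<k. \<Sum>a\<in>Dexp. P a i j * (\<Sum>u\<in>square. \<Sum>v\<in>square.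
     tcoef a (int (fst v) - int (fst u)) (snd u) (snd v) * g j v * cnj (g i u)))"
    unfolding sum_Times
    by (intro sum.cong refl) (simp add: numeral_2_eq_2 g_def Dexp_def algebra_simps)
  also have "\<dots> \<ge> 0" by (rule tcoef_nonneg_S1_pos[OF P])
  finally show "0 \<le> (\<Sum>u\<in>?I. \<Sum>v\<in>?I. ?M 0 u v * x v * cnj (x u) + ?M 0 u v * y v * cnj (y u)
      + ?M 1 u v * y v * cnj (x u) + ?M (-1) u v * x v * cnj (y u))" .
qed simp

lemma sum_reorder_8:
  "(\<Sum>p\<in>S1. \<Sum>q\<in>S2. \<Sum>b\<in>S3. \<Sum>i\<in>S4. \<Sum>r\<in>S5. \<Sum>j\<in>S6. \<Sum>s\<in>S7. \<Sum>a\<in>S8. g p q b i r j s a)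
  = (\<Sum>a\<in>S8. \<Sum>b\<in>S3. \<Sum>r\<in>S5. \<Sum>s\<in>S7. \<Sum>i\<in>S4. \<Sum>j\<in>S6. \<Sum>p\<in>S1. \<Sum>q\<in>S2. g p q b i r j s a)"
  unfolding sum.cartesian_product
  by (rule sum.reindex_bij_witness[where i = "\<lambda>(a,b,r,s,i,j,p,q). (p,q,b,i,r,j,s,a)"
      and j = "\<lambda>(p,q,b,i,r,j,s,a). (a,b,r,s,i,j,p,q)"]) auto

definition upb_functional :: "(int \<Rightarrow> int \<Rightarrow> cmat) \<Rightarrow> complex" where
  "upb_functional X = (\<Sum>a\<in>Dexp. \<Sum>b\<in>Dexp. \<Sum>r<2. \<Sum>s<2. tcoef a b r s * X a b r s)"

text \<open>The scalar matrix \<open>A\<close> of a generator of the cone is absorbed into the test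
  vectors of the doubly paired kernel.\<close>

lemma upb_functional_nonneg:
  assumes "max_D 2 X"
  shows "0 \<le> upb_functional X"
proof -
  obtain k m P Q A where P: "S1_pos k P" and Q: "S1_pos m Q"
    and X: "\<forall>a\<in>Dexp. \<forall>b\<in>Dexp. \<forall>r<2. \<forall>s<2.
         X a b r s = (\<Sum>i<k. \<Sum>j<k. \<Sum>p<m. \<Sum>q<m.
             cnj (A (i*m+p) r) * (P a i j * Q b p q) * A (j*m+q) s)"
    using assms unfolding max_D_def by blast
  define h where "h p u = A (fst u * m + p) (snd u)" for p u
  let ?I = "{..<k}\<times>{..<2::nat}"
  have "0 \<le> (\<Sum>p<m. \<Sum>q<m. \<Sum>b\<in>Dexp. Q b p q * (\<Sum>u\<in>?I. \<Sum>v\<in>?I.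
     (\<Sum>a\<in>Dexp. P a (fst u) (fst v) * tcoef a b (snd u) (snd v)) * h q v * cnj (h p u)))"
    by (rule tcoef_nonneg_S1_pos_S1_pos[OF P Q])
  also have "\<dots> = (\<Sum>p<m. \<Sum>q<m. \<Sum>b\<in>Dexp. \<Sum>u\<in>?I. \<Sum>v\<in>?I. \<Sum>a\<in>Dexp.
     tcoef a b (snd u) (snd v) * (cnj (h p u) * (P a (fst u) (fst v) * Q b p q) * h q v))"
    unfolding sum_distrib_left sum_distrib_right by (intro sum.cong refl) (simp add: mult_ac)
  also have "\<dots> = (\<Sum>p<m. \<Sum>q<m. \<Sum>b\<in>Dexp. \<Sum>i<k. \<Sum>r<2. \<Sum>j<k. \<Sum>s<2. \<Sum>a\<in>Dexp.
     tcoef a b r s * (cnj (A (i*m+p) r) * (P a i j * Q b p q) * A (j*m+q) s))"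
    by (simp only: sum_Times prod.case fst_conv snd_conv h_def)
  also have "\<dots> = (\<Sum>a\<in>Dexp. \<Sum>b\<in>Dexp. \<Sum>r<2. \<Sum>s<2. \<Sum>i<k. \<Sum>j<k. \<Sum>p<m. \<Sum>q<m.
     tcoef a b r s * (cnj (A (i*m+p) r) * (P a i j * Q b p q) * A (j*m+q) s))"
    by (rule sum_reorder_8)
  also have "\<dots> = upb_functional X"
    unfolding upb_functional_def using X by (intro sum.cong refl) (simp add: sum_distrib_left)
  finally show ?thesis .
qed

text \<open>\<open>fone\<close>, \<open>fcos\<close> and \<open>fsin\<close> are the Fourier
  coefficients of 1 and of the real and imaginary parts on the circle.\<close>

definition fone :: "int \<Rightarrow> complex" where "fone a = (if a = 0 then 1 else 0)"

definition fcos :: "int \<Rightarrow> complex" where "fcos a = (if a = 0 then 0 else 1 / 2)"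

definition fsin :: "int \<Rightarrow> complex" where
  "fsin a = (if a = 1 then - \<i> / 2 else if a = -1 then \<i> / 2 else 0)"

text \<open>The first four terms belong, in order, to the four product vectors: each scalar factor
  is twice a squared overlap with a qubit state, and the matrix is the rank one matrix of
  \<open>ck\<close>.\<close>

definition witness :: "real \<Rightarrow> int \<Rightarrow> int \<Rightarrow> cmat" where
  "witness e a b r s =
      (fone a + fcos a) * (fone b - fcos b) * 1
    + (fone a - fcos a) * (fone b + fsin b) * (if r = 0 \<and> s = 0 then 1 else 0)
    + (fone a + fsin a) * (fone b + fcos b) * (if r = 1 \<and> s = 1 then 1 else 0)
    + (fone a - fsin a) * (fone b - fsin b) * (if r = s then 1 else -1)
    - fone a * fone b * (if r = s then of_real e else 0)"

lemma zwk_simps: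
  "zk 0 = 1" "zk (Suc 0) = -1" "zk (Suc (Suc 0)) = \<i>" "zk (Suc (Suc (Suc 0))) = - \<i>"
  "wk 0 = -1" "wk (Suc 0) = \<i>" "wk (Suc (Suc 0)) = 1" "wk (Suc (Suc (Suc 0))) = - \<i>"
  by (auto simp: zk_def wk_def)

text \<open>The four product terms are killed by the complementary projection, and the unit has
  value 4.\<close>

lemma upb_functional_witness:
  "upb_functional (\<lambda>a b r s. witness e a b r s + (if a = 0 \<and> b = 0 \<and> r = s then complex_of_real d else 0))
    = 4 * of_real (d - e)"
  unfolding upb_functional_def
  by (simp add: Dexp_def tcoef_def witness_def fone_def fcos_def fsin_def zwk_simps ck_def nk_def
      eval_nat_numeral algebra_simps)

section \<open>The witness against 2-positivity\<close>

definition gap :: "complex \<Rightarrow> complex \<Rightarrow> complex \<Rightarrow> complex \<Rightarrow> real" where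
  "gap z w p q = (1 + Re z) * (1 - Re w) * (cmod (p + q))\<^sup>2 + (1 - Re z) * (1 + Im w) * (cmod p)\<^sup>2
    + (1 + Im z) * (1 + Re w) * (cmod q)\<^sup>2 + (1 - Im z) * (1 - Im w) * (cmod (p - q))\<^sup>2"

text \<open>A point of the circle is a zero of at most one of the factors belonging to its variable,
  so a point of the torus kills at most two of the four products.\<close>

lemma no_three_vanish:
  fixes c s c' s' :: real
  assumes "c\<^sup>2 + s\<^sup>2 = 1" "c'\<^sup>2 + s'\<^sup>2 = 1"
  shows "(1 + c) * (1 - c') \<noteq> 0 \<or> (1 - c) * (1 + s') \<noteq> 0 \<or> (1 + s) * (1 + c') \<noteq> 0"
    and "(1 + c) * (1 - c') \<noteq> 0 \<or> (1 - c) * (1 + s') \<noteq> 0 \<or> (1 - s) * (1 - s') \<noteq> 0"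
    and "(1 + c) * (1 - c') \<noteq> 0 \<or> (1 + s) * (1 + c') \<noteq> 0 \<or> (1 - s) * (1 - s') \<noteq> 0"
    and "(1 - c) * (1 + s') \<noteq> 0 \<or> (1 + s) * (1 + c') \<noteq> 0 \<or> (1 - s) * (1 - s') \<noteq> 0"
proof -
  have eqs: "1 + x = 0 \<longleftrightarrow> x = -1" "1 - x = 0 \<longleftrightarrow> x = 1" for x :: real by auto
  show "(1 + c) * (1 - c') \<noteq> 0 \<or> (1 - c) * (1 + s') \<noteq> 0 \<or> (1 + s) * (1 + c') \<noteq> 0"
    and "(1 + c) * (1 - c') \<noteq> 0 \<or> (1 - c) * (1 + s') \<noteq> 0 \<or> (1 - s) * (1 - s') \<noteq> 0"
    and "(1 + c) * (1 - c') \<noteq> 0 \<or> (1 + s) * (1 + c') \<noteq> 0 \<or> (1 - s) * (1 - s') \<noteq> 0"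
    and "(1 - c) * (1 + s') \<noteq> 0 \<or> (1 + s) * (1 + c') \<noteq> 0 \<or> (1 - s) * (1 - s') \<noteq> 0"
    using assms unfolding mult_eq_0_iff eqs by auto
qed

lemma gap_pos:
  assumes z: "cmod z = 1" and w: "cmod w = 1" and v: "p \<noteq> 0 \<or> q \<noteq> 0"
  shows "gap z w p q > 0"
proof -
  have cs: "(Re z)\<^sup>2 + (Im z)\<^sup>2 = 1" "(Re w)\<^sup>2 + (Im w)\<^sup>2 = 1"
    using z w by (auto simp: cmod_def)
  have b: "\<bar>Re z\<bar> \<le> 1" "\<bar>Im z\<bar> \<le> 1" "\<bar>Re w\<bar> \<le> 1" "\<bar>Im w\<bar> \<le> 1"
    using z w abs_Re_le_cmod abs_Im_le_cmod by metis+
  define a1 where "a1 = (1 + Re z) * (1 - Re w)"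
  define a2 where "a2 = (1 - Re z) * (1 + Im w)"
  define a3 where "a3 = (1 + Im z) * (1 + Re w)"
  define a4 where "a4 = (1 - Im z) * (1 - Im w)"
  have nn: "a1 \<ge> 0" "a2 \<ge> 0" "a3 \<ge> 0" "a4 \<ge> 0"
    using b unfolding a1_def a2_def a3_def a4_def by (intro mult_nonneg_nonneg; simp)+
  have g: "gap z w p q = a1 * (cmod (p + q))\<^sup>2 + a2 * (cmod p)\<^sup>2 + a3 * (cmod q)\<^sup>2 + a4 * (cmod (p - q))\<^sup>2"
    by (simp add: gap_def a1_def a2_def a3_def a4_def)
  have t: "a1 * (cmod (p + q))\<^sup>2 \<ge> 0" "a2 * (cmod p)\<^sup>2 \<ge> 0" "a3 * (cmod q)\<^sup>2 \<ge> 0" "a4 * (cmod (p - q))\<^sup>2 \<ge> 0"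
    using nn by auto
  have "gap z w p q \<noteq> 0"
  proof
    assume "gap z w p q = 0"
    then have "a1 * (cmod (p + q))\<^sup>2 = 0" "a2 * (cmod p)\<^sup>2 = 0" "a3 * (cmod q)\<^sup>2 = 0" "a4 * (cmod (p - q))\<^sup>2 = 0"
      using g t by linarith+
    then have z: "a1 = 0 \<or> p + q = 0" "a2 = 0 \<or> p = 0" "a3 = 0 \<or> q = 0" "a4 = 0 \<or> p = q"
      by auto
    \<comment> \<open>At least two coefficients survive, and any two of the linear forms
      \<open>p + q\<close>, \<open>p\<close>, \<open>q\<close>, \<open>p - q\<close> vanish together
      only at the origin.\<close>
    note nv = no_three_vanish[OF cs, folded a1_def a2_def a3_def a4_def]
    show False
      using z nv v by auto
  qed
  then show ?thesis using g t by linarith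
qed

text \<open>The minimum over the compact product of the torus and the unit sphere is positive;
  degree 2 homogeneity in \<open>(p, q)\<close> extends the bound.\<close>

lemma gap_lower_bound:
  obtains e where "e > 0" "\<And>z w p q. cmod z = 1 \<Longrightarrow> cmod w = 1 \<Longrightarrow>
     e * ((cmod p)\<^sup>2 + (cmod q)\<^sup>2) \<le> gap z w p q"
proof -
  let ?K = "sphere (0::complex) 1 \<times> sphere (0::complex) 1 \<times> sphere (0 :: complex \<times> complex) 1"
  let ?f = "\<lambda>x. gap (fst x) (fst (snd x)) (fst (snd (snd x))) (snd (snd (snd x)))"
  have "compact ?K" by (intro compact_Times compact_sphere)
  moreover have "(1, 1, 1, 0) \<in> ?K" by (simp add: norm_prod_def)
  then have "?K \<noteq> {}" by blast
  moreover have "continuous_on ?K ?f"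
    unfolding gap_def by (intro continuous_intros)
  ultimately obtain x where x: "x \<in> ?K" "\<And>y. y \<in> ?K \<Longrightarrow> ?f x \<le> ?f y"
    using continuous_attains_inf[of ?K ?f] by blast
  have "fst (snd (snd x)) \<noteq> 0 \<or> snd (snd (snd x)) \<noteq> 0"
    using x(1) by (auto simp: norm_prod_def)
  then have "?f x > 0"
    using x(1) by (intro gap_pos) auto
  moreover have "?f x * ((cmod p)\<^sup>2 + (cmod q)\<^sup>2) \<le> gap z w p q"
    if zw: "cmod z = 1" "cmod w = 1" for z w p q
  proof (cases "p = 0 \<and> q = 0")
    case False
    define n where "n = sqrt ((cmod p)\<^sup>2 + (cmod q)\<^sup>2)"
    have n: "n > 0" using False by (auto simp: n_def add_nonneg_pos add_pos_nonneg)
    have n2: "n\<^sup>2 = (cmod p)\<^sup>2 + (cmod q)\<^sup>2" by (simp add: n_def)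
    have "(cmod (p / of_real n))\<^sup>2 + (cmod (q / of_real n))\<^sup>2 = 1"
      using n n2 False by (simp add: norm_divide power_divide flip: add_divide_distrib)
    then have "(z, w, p / of_real n, q / of_real n) \<in> ?K"
      using zw by (simp add: norm_prod_def)
    from x(2)[OF this] have "?f x \<le> gap z w (p / of_real n) (q / of_real n)" by simp
    also have "\<dots> = gap z w p q / n\<^sup>2"
    proof -
      have "cmod (p / of_real n + q / of_real n) = cmod (p + q) / n"
        "cmod (p / of_real n - q / of_real n) = cmod (p - q) / n"
        using n by (simp_all add: norm_divide flip: add_divide_distrib diff_divide_distrib)
      then show ?thesis using n
        by (simp add: gap_def norm_divide power_divide add_divide_distrib)
    qed
    finally show ?thesis unfolding n2[symmetric] using n by (simp add: pos_le_divide_eq)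
  qed (simp add: gap_def)
  ultimately show thesis by (rule that)
qed

lemma sum_separate:
  "(\<Sum>a\<in>Dexp. \<Sum>b\<in>Dexp. f a * g b * c * z powi a * w powi b)
    = (\<Sum>a\<in>Dexp. f a * z powi a) * (\<Sum>b\<in>Dexp. g b * w powi b) * c" for z w c :: complex
  by (simp add: Dexp_def algebra_simps)

lemma trig_sums:
  assumes "cmod z = 1"
  shows "(\<Sum>a\<in>Dexp. fone a * z powi a) = 1"
    and "(\<Sum>a\<in>Dexp. fcos a * z powi a) = of_real (Re z)"
    and "(\<Sum>a\<in>Dexp. fsin a * z powi a) = of_real (Im z)"
  using assms
  by (auto simp: Dexp_def fone_def fcos_def fsin_def cnj_eq_inverse complex_eq_iff)

lemma witness_form:
  assumes z: "cmod z = 1" and w: "cmod w = 1"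
  shows "(\<Sum>r<2. \<Sum>s<2. cnj (v r) * (\<Sum>a\<in>Dexp. \<Sum>b\<in>Dexp. witness e a b r s * z powi a * w powi b) * v s)
    = of_real (gap z w (v 0) (v 1) - e * ((cmod (v 0))\<^sup>2 + (cmod (v 1))\<^sup>2))"
proof -
  have F: "(\<Sum>a\<in>Dexp. \<Sum>b\<in>Dexp. witness e a b r s * z powi a * w powi b) =
      of_real ((1 + Re z) * (1 - Re w)) + of_real ((1 - Re z) * (1 + Im w)) * (if r = 0 \<and> s = 0 then 1 else 0)
      + of_real ((1 + Im z) * (1 + Re w)) * (if r = 1 \<and> s = 1 then 1 else 0)
      + of_real ((1 - Im z) * (1 - Im w)) * (if r = s then 1 else -1)
      - (if r = s then of_real e else 0)" for r s
    unfolding witness_def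
    unfolding left_diff_distrib[of _ _ "z powi _"] distrib_right[of _ _ "z powi _"]
      left_diff_distrib[of _ _ "w powi _"] distrib_right[of _ _ "w powi _"]
      sum_subtractf sum.distrib sum_separate
    unfolding left_diff_distrib[of _ _ "z powi _"] distrib_right[of _ _ "z powi _"]
      left_diff_distrib[of _ _ "w powi _"] distrib_right[of _ _ "w powi _"]
      sum_subtractf sum.distrib trig_sums[OF z] trig_sums[OF w]
    by simp
  have cm: "complex_of_real ((cmod u)\<^sup>2) = u * cnj u" for u by (rule complex_norm_square)
  show ?thesis
    unfolding F gap_def of_real_diff of_real_add of_real_mult cm
    by (simp add: numeral_2_eq_2 algebra_simps)
qed

lemma witness_min_pos:
  obtains e where "e > 0" "min_pos 2 (witness e)"
proof -
  obtain e where e: "e > 0" "\<And>z w p q. cmod z = 1 \<Longrightarrow> cmod w = 1 \<Longrightarrow>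
     e * ((cmod p)\<^sup>2 + (cmod q)\<^sup>2) \<le> gap z w p q"
    using gap_lower_bound by blast
  have "min_pos 2 (witness e)"
    unfolding min_pos_def psd_def
  proof (intro allI impI)
    fix z w :: complex and v :: "nat \<Rightarrow> complex"
    assume zw: "cmod z = 1" "cmod w = 1"
    show "0 \<le> (\<Sum>r<2. \<Sum>s<2. cnj (v r) * (\<Sum>a\<in>Dexp. \<Sum>b\<in>Dexp. witness e a b r s * z powi a * w powi b) * v s)"
      unfolding witness_form[OF zw] using e(2)[OF zw] by (simp add: less_eq_complex_def)
  qed
  then show thesis using e(1) that by blast
qed

lemma not_max_pos_witness:
  assumes "e > 0"
  shows "\<not> max_pos 2 (witness e)"
proof
  assume "max_pos 2 (witness e)"
  \<comment> \<open>A perturbation smaller than \<open>e\<close> leaves the functional negative, so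
    the failure survives Archimedeanization.\<close>
  moreover have "e / 2 > 0" using assms by simp
  ultimately have "max_D 2 (\<lambda>a b r s. witness e a b r s +
      (if a = 0 \<and> b = 0 \<and> r = s then complex_of_real (e / 2) else 0))"
    unfolding max_pos_def by blast
  from upb_functional_nonneg[OF this] have "0 \<le> 4 * complex_of_real (e / 2 - e)"
    by (simp only: upb_functional_witness)
  then show False using assms by (simp add: less_eq_complex_def)
qed

theorem theorem3p7:
  shows "(\<forall>X. min_pos 1 X \<longrightarrow> max_pos 1 X)
     \<and> (\<exists>X. min_pos 2 X \<and> \<not> max_pos 2 X)
     \<and> (\<forall>n X. comm_pos TYPE('i) n X \<longleftrightarrow> min_pos n X)
     \<and> (\<exists>n X. min_pos n X \<and> \<not> max_pos n X)"
proof -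
  obtain e where "min_pos 2 (witness e)" "\<not> max_pos 2 (witness e)"
    using witness_min_pos not_max_pos_witness by metis
  then show ?thesis
    using min_pos_1_imp_max_pos min_pos_imp_comm_pos comm_pos_imp_min_pos by blast
qed

end
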